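(* Let $d\ge3$ be an integer, $1<p\le+\infty$ and $1\le q\le+\infty$. Then the metrics $W_p$ and $SW_{p,q}$ on $\mathcal{P}_p(\mathbb{R}^d)$ are not bi-Lipschitz equivalent, nor are they equivalent along geodesics of $(\mathcal{P}_p(\mathbb{R}^d),SW_{p,q})$; that is, there is a geodesic $(\mu_t)_{t\in[0,1]}$ in $(\mathcal{P}_p(\mathbb{R}^d),SW_{p,q})$ such that the restrictions of $W_p$ and $SW_{p,q}$ to the set $\{\mu_t:t\in[0,1]\}$ are not bi-Lipschitz equivalent.
   Context: For $1\le p<+\infty$, $\mathcal{P}_p(\mathbb{R}^d)$ is the set of Borel probability measures on $\mathbb{R}^d$ with finite $p$-th moment; $\mathcal{P}_\infty(\mathbb{R}^d)$ is the set of Borel probability measures with bounded support. $W_p$ denotes the $p$-Wasserstein distance with respect to the Euclidean distance (on $\mathbb{R}^d$, or on $\mathbb{R}$ for one-dimensional measures); $W_\infty(\mu,\nu)$ is the infimum over couplings $\gamma$ of $\mu,\nu$ of the $\gamma$-essential supremum of $|x-y|$. For $\theta\in\mathbb{S}^{d-1}$ let $R^\theta:\mathbb{R}^d\to\mathbb{R}$, $R^\theta(x)=x\cdot\theta$, and let $f_\sharp\mu$ be the push-forward of $\mu$ by $f$. For $\mu,\nu\in\mathcal{P}_p(\mathbb{R}^d)$ the $p,q$ sliced Wasserstein metric is $$SW_{p,q}(\mu,\nu)=\left[\frac{1}{\mathcal{H}^{d-1}(\mathbb{S}^{d-1})}\int_{\mathbb{S}^{d-1}}\big(W_p(R^\theta_\sharp\mu,R^\theta_\sharp\nu)\big)^q\,d\mathcal{H}^{d-1}(\theta)\right]^{1/q},$$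 where for $q=+\infty$ this is understood as $\sup_{\theta\in\mathbb{S}^{d-1}}W_p(R^\theta_\sharp\mu,R^\theta_\sharp\nu)$, and $\mathcal{H}^{k}$ is $k$-dimensional Hausdorff measure. Two metrics $\rho_1,\rho_2$ on the same set $X$ are bi-Lipschitz equivalent if there is a constant $C\ge1$ with $C^{-1}\rho_1(\mu,\nu)\le\rho_2(\mu,\nu)\le C\rho_1(\mu,\nu)$ for all $\mu,\nu\in X$. A geodesic in $(\mathcal{P}_p(\mathbb{R}^d),SW_{p,q})$ is a curve $(\mu_t)_{t\in[0,1]}$ in $\mathcal{P}_p(\mathbb{R}^d)$ with $SW_{p,q}(\mu_t,\mu_s)=|t-s|\,SW_{p,q}(\mu_0,\mu_1)$ for all $s,t\in[0,1]$. *)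

theory Defs
  imports "HOL-Probability.Probability"
begin

text \<open>
  The covering sets are required to be bounded because \<^const>\<open>diameter\<close> is unspecified on
  unbounded sets. The case distinction on the empty set matters only for \<open>k = 0\<close>,
  where \<open>0 ^ 0 = 1\<close>.
\<close>

definition hausdorff_content :: "nat \<Rightarrow> real \<Rightarrow> 'a::metric_space set \<Rightarrow> ennreal" where
  "hausdorff_content k \<delta> A =
     (INF E \<in> {E :: nat \<Rightarrow> 'a set. A \<subseteq> (\<Union>i. E i) \<and> (\<forall>i. bounded (E i) \<and> diameter (E i) \<le> \<delta>)}.
        \<Sum>i. if E i = {} then 0
            else ennreal (unit_ball_vol (real k) * (diameter (E i) / 2) ^ k))"

definition hausdorff_outer_measure :: "nat \<Rightarrow> 'a::metric_space set \<Rightarrow> ennreal" where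
  "hausdorff_outer_measure k A = (SUP \<delta> \<in> {0<..}. hausdorff_content k \<delta> A)"

text \<open>
  The restriction of a metric outer measure to the Borel sets is countably additive, so
  \<^const>\<open>measure_of\<close> does not fall back to the null measure here.
\<close>

definition hausdorff_measure :: "nat \<Rightarrow> 'a::metric_space measure" where
  "hausdorff_measure k = measure_of UNIV (sets borel) (hausdorff_outer_measure k)"

definition measure_support :: "'a::topological_space measure \<Rightarrow> 'a set" where
  "measure_support \<mu> = {x. \<forall>U. open U \<and> x \<in> U \<longrightarrow> emeasure \<mu> U > 0}"

definition wasserstein_space :: "ennreal \<Rightarrow> 'a::euclidean_space measure set" where
  "wasserstein_space p =
     {\<mu>. prob_space \<mu> \<and> sets \<mu> = sets borel \<and>
         (if p = \<infinity> then bounded (measure_support \<mu>)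
          else (\<integral>\<^sup>+ x. ennreal (norm x powr enn2real p) \<partial>\<mu>) < \<infinity>)}"

definition couplings :: "'a::euclidean_space measure \<Rightarrow> 'a measure \<Rightarrow> ('a \<times> 'a) measure set" where
  "couplings \<mu> \<nu> =
     {\<gamma>. prob_space \<gamma> \<and> sets \<gamma> = sets borel \<and> distr \<gamma> borel fst = \<mu> \<and> distr \<gamma> borel snd = \<nu>}"

text \<open>
  On \<^term>\<open>wasserstein_space p\<close> the infima are finite, so nothing is lost by
  \<^const>\<open>enn2real\<close>.
\<close>

definition wasserstein :: "ennreal \<Rightarrow> 'a::euclidean_space measure \<Rightarrow> 'a measure \<Rightarrow> real" where
  "wasserstein p \<mu> \<nu> =
     (if p = \<infinity> then enn2real (INF \<gamma> \<in> couplings \<mu> \<nu>. esssup \<gamma> (\<lambda>(x, y). ennreal (dist x y)))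
      else enn2real (INF \<gamma> \<in> couplings \<mu> \<nu>. \<integral>\<^sup>+ (x, y). ennreal (dist x y powr enn2real p) \<partial>\<gamma>)
             powr (1 / enn2real p))"

definition slice :: "'a::euclidean_space \<Rightarrow> 'a measure \<Rightarrow> real measure" where
  "slice \<theta> \<mu> = distr \<mu> borel (\<lambda>x. x \<bullet> \<theta>)"

text \<open>
  For \<open>\<mu>\<close>, \<open>\<nu>\<close> in \<^term>\<open>wasserstein_space p\<close> with \<open>1 \<le> p\<close>, the function
  \<open>\<theta> \<mapsto> wasserstein p (slice \<theta> \<mu>) (slice \<theta> \<nu>)\<close> is continuous,
  hence bounded and integrable on the sphere.
\<close>

definition sliced_wasserstein ::
  "ennreal \<Rightarrow> ennreal \<Rightarrow> 'a::euclidean_space measure \<Rightarrow> 'a measure \<Rightarrow> real" where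
  "sliced_wasserstein p q \<mu> \<nu> =
     (if q = \<infinity> then (SUP \<theta> \<in> sphere 0 1. wasserstein p (slice \<theta> \<mu>) (slice \<theta> \<nu>))
      else (1 / measure (hausdorff_measure (DIM('a) - 1)) (sphere (0::'a) 1) *
             (LINT \<theta>:sphere 0 1|hausdorff_measure (DIM('a) - 1).
                wasserstein p (slice \<theta> \<mu>) (slice \<theta> \<nu>) powr enn2real q))
           powr (1 / enn2real q))"

definition bi_lipschitz_equivalent :: "'b set \<Rightarrow> ('b \<Rightarrow> 'b \<Rightarrow> real) \<Rightarrow> ('b \<Rightarrow> 'b \<Rightarrow> real) \<Rightarrow> bool" where
  "bi_lipschitz_equivalent X \<rho>\<^sub>1 \<rho>\<^sub>2 \<longleftrightarrow>
     (\<exists>C\<ge>1. \<forall>x\<in>X. \<forall>y\<in>X. inverse C * \<rho>\<^sub>1 x y \<le> \<rho>\<^sub>2 x y \<and> \<rho>\<^sub>2 x y \<le> C * \<rho>\<^sub>1 x y)"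

definition geodesic_in :: "'b set \<Rightarrow> ('b \<Rightarrow> 'b \<Rightarrow> real) \<Rightarrow> (real \<Rightarrow> 'b) \<Rightarrow> bool" where
  "geodesic_in X \<rho> c \<longleftrightarrow>
     (\<forall>t\<in>{0..1}. c t \<in> X) \<and>
     (\<forall>s\<in>{0..1}. \<forall>t\<in>{0..1}. \<rho> (c t) (c s) = \<bar>t - s\<bar> * \<rho> (c 0) (c 1))"

end

theory Submission
  imports Defs
begin

text \<open>
  Let \<open>\<sigma>\<^sub>r\<close> be the uniform measure on the sphere of radius \<open>r\<close> in a three-dimensional coordinate subspace,
  and let \<open>P\<close> be the orthogonal projection to that subspace. By Archimedes, the slice of \<open>\<sigma>\<^sub>r\<close> in the
  direction \<open>\<theta>\<close> is uniform on the interval with half-length \<open>r \<bar>P \<theta>\<bar>\<close>. So the slices of mixtures of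
  such spheres are, up to the dilation by \<open>\<bar>P \<theta>\<bar>\<close>, the symmetric laws on the line that are
  unimodal at \<open>0\<close>. Unimodality means that the quantile function is convex on the upper half
  of the mass, and this survives linear interpolation of quantile functions, which yields the geodesics
  of \<open>W\<^sub>p\<close> on the line. Thus any two mixtures are joined by a curve of mixtures all of whose slices
  are geodesics at the same time.

  The curve used here is
  \<open>\<mu>\<^sub>t = a\<^sub>t \<sigma>\<^sub>r + (1 - a\<^sub>t) \<sigma>\<^sub>R\<close> with \<open>r = 1/2\<close>, \<open>R = 1 + t/2\<close> and \<open>a\<^sub>t = t / (2 (1 + t))\<close>.
  For \<open>U\<close> uniform on \<open>[-1, 1]\<close>, its slice in the direction \<open>\<theta>\<close> is the law of
  \<open>\<bar>P \<theta>\<bar> spread t U\<close>, where \<open>spread t\<close> is odd, equals \<open>u\<close> on \<open>[0, 1/2]\<close> and has slope \<open>1 + t\<close>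
  on \<open>[1/2, 1]\<close> (\<open>slice_mixture\<close>, proved by comparing moments). The monotone coupling is optimal on the
  line, so the distance between the slices at times \<open>s\<close> and \<open>t\<close> is
  \<open>\<bar>t - s\<bar> \<bar>P \<theta>\<bar>\<close> times a constant that depends only on \<open>p\<close> (\<open>wasserstein_line_law\<close>). The factor
  \<open>\<bar>t - s\<bar>\<close> comes out of the average or supremum over the directions, whatever measure is used for the
  average, and \<open>\<mu>\<close> is a geodesic for the sliced distance.

  In the ambient space, however, the two spheres stay apart: passing from \<open>\<mu>\<^sub>0 = \<sigma>\<^sub>1\<close> to \<open>\<mu>\<^sub>t\<close>
  requires moving the mass \<open>a\<^sub>t\<close>, which is of order \<open>t\<close>, over a distance of at least \<open>1/2\<close>. Hence the
  Wasserstein distance is at least of order \<open>t\<close> to the power \<open>1/p\<close> (\<open>wasserstein_mixture_ge\<close>), which for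
  \<open>p > 1\<close> is not \<open>O(t)\<close>. The two metrics are therefore not bi-Lipschitz equivalent along the curve, nor on any
  larger set.
\<close>

section \<open>Bounded laws with equal moments\<close>

text \<open>
  On variables bounded by \<open>B\<close>, the characteristic function at \<open>t\<close> differs from its Taylor polynomial of
  order \<open>n\<close>, whose coefficients are moments, by at most \<open>2 (\<bar>t\<bar> B)\<^sup>n / n!\<close>. Hence the moments
  determine the characteristic function and so the law.
\<close>

lemma distr_eq_of_moments:
  fixes X :: "'b \<Rightarrow> real" and Y :: "'c \<Rightarrow> real"
  assumes M: "prob_space M" "X \<in> borel_measurable M" "AE x in M. \<bar>X x\<bar> \<le> B"
    and N: "prob_space N" "Y \<in> borel_measurable N" "AE y in N. \<bar>Y y\<bar> \<le> B"
    and eq: "\<And>n. (\<integral>x. X x ^ n \<partial>M) = (\<integral>y. Y y ^ n \<partial>N)"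
  shows "distr M borel X = distr N borel Y"
proof -
  have approx: "cmod (char (distr K borel Z) t - (\<Sum>k\<le>n. ((\<i> * t)^k / fact k) * (\<integral>x. Z x ^ k \<partial>K)))
        \<le> 2 * ((\<bar>t\<bar> * B) ^ n / fact n)"
    if K: "prob_space K" "Z \<in> borel_measurable K" "AE x in K. \<bar>Z x\<bar> \<le> B"
    for K :: "'d measure" and Z :: "'d \<Rightarrow> real" and t n
  proof -
    interpret K: prob_space K by fact
    note [measurable] = K(2)
    interpret D: real_distribution "distr K borel Z"
      by (intro K.real_distribution_distr) simp
    have bnd: "AE x in K. norm (Z x ^ k) \<le> B ^ k" for k
      using K(3) by eventually_elim (auto simp: power_abs intro!: power_mono)
    have int: "integrable K (\<lambda>x. Z x ^ k)" for k
      using bnd by (intro K.integrable_const_bound[where B = "B ^ k"]) auto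
    have "(\<integral>x. \<bar>Z x\<bar> ^ n \<partial>K) \<le> (\<integral>x. B ^ n \<partial>K)"
      using bnd[of n] integrable_abs[OF int[of n]] by (intro integral_mono_AE) (auto simp: power_abs)
    then have le: "(\<integral>x. \<bar>Z x\<bar> ^ n \<partial>K) \<le> B ^ n" by (simp add: K.prob_space)
    have "cmod (char (distr K borel Z) t
        - (\<Sum>k\<le>n. ((\<i> * t)^k / fact k) * D.expectation (\<lambda>x. x^k)))
        \<le> (2 * \<bar>t\<bar> ^ n / fact n) * D.expectation (\<lambda>x. \<bar>x\<bar> ^ n)"
      using int by (intro D.char_approx1) (auto simp: integrable_distr_eq)
    also have "D.expectation (\<lambda>x. \<bar>x\<bar> ^ n) = (\<integral>x. \<bar>Z x\<bar> ^ n \<partial>K)"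
      by (simp add: integral_distr)
    also have "(2 * \<bar>t\<bar> ^ n / fact n) * \<dots> \<le> (2 * \<bar>t\<bar> ^ n / fact n) * B ^ n"
      using le by (intro mult_left_mono) auto
    finally show ?thesis by (simp add: integral_distr power_mult_distrib)
  qed
  have "char (distr M borel X) t = char (distr N borel Y) t" for t
  proof -
    have "cmod (char (distr M borel X) t - char (distr N borel Y) t)
        \<le> 4 * ((\<bar>t\<bar> * B) ^ n / fact n)" for n
      using norm_triangle_mono[OF approx[OF M, of t n] approx[OF N, of t n, unfolded norm_minus_commute[of "char _ t"]]]
      by (simp add: eq)
    moreover have "(\<lambda>n. 4 * ((\<bar>t\<bar> * B) ^ n / fact n)) \<longlonglongrightarrow> 4 * 0"
      using summable_LIMSEQ_zero[OF summable_exp[of "\<bar>t\<bar> * B"]]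
      by (intro tendsto_mult tendsto_const) (simp add: divide_inverse mult.commute)
    ultimately have "cmod (char (distr M borel X) t - char (distr N borel Y) t) \<le> 0"
      by (intro LIMSEQ_le_const[where X = "\<lambda>n. 4 * ((\<bar>t\<bar> * B) ^ n / fact n)"]) auto
    then show ?thesis by simp
  qed
  then show ?thesis
    using M N by (intro Levy_uniqueness prob_space.real_distribution_distr) auto
qed

section \<open>Uniform laws on intervals\<close>

definition unif :: "real \<Rightarrow> real \<Rightarrow> real measure" where
  "unif a b = uniform_measure lborel {a..b}"

lemma sets_unif [measurable_cong, simp]: "sets (unif a b) = sets borel"
  by (simp add: unif_def)

lemma space_unif [simp]: "space (unif a b) = UNIV"
  by (simp add: unif_def)

lemma prob_space_unif: "a < b \<Longrightarrow> prob_space (unif a b)"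
  unfolding unif_def by (rule prob_space_uniform_measure) auto

lemma AE_unif: "AE x in unif a b. a \<le> x \<and> x \<le> b"
  unfolding unif_def by (intro AE_uniform_measureI) auto

lemma integral_unif:
  fixes f :: "real \<Rightarrow> real"
  assumes "a < b" and cont: "continuous_on UNIV f" and I: "(f has_integral I) {a..b}"
  shows "integral\<^sup>L (unif a b) f = I / (b - a)"
proof -
  have [measurable]: "f \<in> borel_measurable borel"
    using cont by (rule borel_measurable_continuous_onI)
  have si: "set_integrable lborel {a..b} f"
    by (rule borel_integrable_atLeastAtMost') (rule continuous_on_subset[OF cont], simp)
  have "integral\<^sup>L (unif a b) f = (\<integral>x. (indicator {a..b} x / (b - a)) *\<^sub>R f x \<partial>lborel)"
    unfolding unif_def uniform_measure_def using \<open>a < b\<close>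
    by (subst integral_density[symmetric])
       (auto intro!: arg_cong2[where f = "integral\<^sup>L"] arg_cong2[where f = density]
             simp: fun_eq_iff indicator_def divide_ennreal[symmetric] ennreal_1[symmetric] simp del: ennreal_1)
  also have "\<dots> = (LINT x:{a..b}|lborel. f x) / (b - a)"
    by (simp add: set_lebesgue_integral_def)
  also have "(LINT x:{a..b}|lborel. f x) = I"
    using set_borel_integral_eq_integral(2)[OF si] I by (simp add: integral_unique)
  finally show ?thesis .
qed

lemma integral_unif_FTC:
  fixes f F :: "real \<Rightarrow> real"
  assumes "a < b" and "continuous_on UNIV f"
    and "\<And>x. (F has_real_derivative f x) (at x)"
  shows "integral\<^sup>L (unif a b) f = (F b - F a) / (b - a)"
  using assms
  by (intro integral_unif fundamental_theorem_of_calculus)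
     (auto simp: has_real_derivative_iff_has_vector_derivative[symmetric] intro: has_field_derivative_at_within)

lemma integrable_unif:
  fixes f :: "real \<Rightarrow> real"
  assumes "a < b" and cont: "continuous_on UNIV f"
  shows "integrable (unif a b) f"
proof -
  interpret prob_space "unif a b" using assms(1) by (rule prob_space_unif)
  have [measurable]: "f \<in> borel_measurable borel"
    using cont by (rule borel_measurable_continuous_onI)
  have "compact (f ` {a..b})"
    using cont by (intro compact_continuous_image) (auto intro: continuous_on_subset)
  then have "bounded (f ` {a..b})" by (rule compact_imp_bounded)
  then obtain B where "\<forall>y\<in>f ` {a..b}. norm y \<le> B" unfolding bounded_iff ..
  then have "AE x in unif a b. norm (f x) \<le> B"
    using \<open>\<forall>y\<in>f ` {a..b}. norm y \<le> B\<close> by (intro eventually_mono[OF AE_unif[of a b]]) auto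
  then show ?thesis
    by (rule integrable_const_bound) simp
qed

section \<open>Projections of the uniform measure on the 2-sphere\<close>

text \<open>
  The function \<open>h = a cos + b sin\<close> satisfies \<open>h'' = - h\<close> and \<open>h'\<^sup>2 + h\<^sup>2 = a\<^sup>2 + b\<^sup>2\<close>, so the
  derivative of the periodic function \<open>h\<^sup>k\<^sup>+\<^sup>1 h'\<close> is a combination of \<open>h\<^sup>k\<close> and \<open>h\<^sup>k\<^sup>+\<^sup>2\<close>
  with integral zero. Only \<open>a\<^sup>2 + b\<^sup>2\<close> enters, which is the symmetry about the polar axis.
\<close>

lemma integral_trig_power_recurrence:
  fixes a b :: real
  defines "J \<equiv> \<lambda>k. \<integral>\<phi>. (a * cos \<phi> + b * sin \<phi>) ^ k \<partial>unif 0 (2 * pi)"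
  shows "J 0 = 1" and "J 1 = 0"
    and "real (k + 2) * J (k + 2) = real (k + 1) * (a\<^sup>2 + b\<^sup>2) * J k"
proof -
  have pi: "0 < 2 * pi" by simp
  interpret prob_space "unif 0 (2 * pi)" by (rule prob_space_unif[OF pi])
  show "J 0 = 1" by (simp add: J_def prob_space[simplified])
  show "J 1 = 0"
    unfolding J_def power_one_right
    by (subst integral_unif_FTC[OF pi, where F = "\<lambda>\<phi>. a * sin \<phi> - b * cos \<phi>"])
       (auto intro!: continuous_intros derivative_eq_intros)
  let ?h = "\<lambda>\<phi>. a * cos \<phi> + b * sin \<phi>" and ?h' = "\<lambda>\<phi>. b * cos \<phi> - a * sin \<phi>"
  have sq: "(?h' \<phi>)\<^sup>2 = a\<^sup>2 + b\<^sup>2 - (?h \<phi>)\<^sup>2" for \<phi>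
    using sin_cos_squared_add[of \<phi>] by algebra
  have int: "integrable (unif 0 (2 * pi)) (\<lambda>\<phi>. ?h \<phi> ^ k)" for k
    by (intro integrable_unif pi continuous_intros)
  have "(\<integral>\<phi>. real (k + 1) * (a\<^sup>2 + b\<^sup>2) * ?h \<phi> ^ k - real (k + 2) * ?h \<phi> ^ (k + 2) \<partial>unif 0 (2 * pi))
     = (?h (2 * pi) ^ (k + 1) * ?h' (2 * pi) - ?h 0 ^ (k + 1) * ?h' 0) / (2 * pi - 0)"
  proof (rule integral_unif_FTC[OF pi])
    fix \<phi>
    have "real (k + 1) * ?h \<phi> ^ k * (?h' \<phi>)\<^sup>2 - ?h \<phi> ^ (k + 1) * ?h \<phi>
        = real (k + 1) * (a\<^sup>2 + b\<^sup>2) * ?h \<phi> ^ k - real (k + 2) * ?h \<phi> ^ (k + 2)"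
      unfolding sq by (simp add: algebra_simps power2_eq_square)
    moreover have "(?h has_real_derivative ?h' \<phi>) (at \<phi>)"
      and "(?h' has_real_derivative - ?h \<phi>) (at \<phi>)"
      by (auto intro!: derivative_eq_intros)
    then have "((\<lambda>\<phi>. ?h \<phi> ^ (k + 1) * ?h' \<phi>) has_real_derivative
        real (k + 1) * (?h' \<phi> * ?h \<phi> ^ (k + 1 - Suc 0)) * ?h' \<phi> + - ?h \<phi> * ?h \<phi> ^ (k + 1)) (at \<phi>)"
      by (intro DERIV_mult DERIV_power)
    ultimately show "((\<lambda>\<phi>. ?h \<phi> ^ (k + 1) * ?h' \<phi>) has_real_derivative
        real (k + 1) * (a\<^sup>2 + b\<^sup>2) * ?h \<phi> ^ k - real (k + 2) * ?h \<phi> ^ (k + 2)) (at \<phi>)"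
      by (elim DERIV_cong) (simp add: power2_eq_square mult_ac del: minus_add_distrib)
  qed (intro continuous_intros)
  also have "\<dots> = 0" by simp
  finally show "real (k + 2) * J (k + 2) = real (k + 1) * (a\<^sup>2 + b\<^sup>2) * J k"
    using int[of k] int[of "k + 2"] by (simp add: J_def del: power_Suc add_2_eq_Suc' of_nat_add of_nat_Suc)
qed

text \<open>
  These Beta integrals are the moments of the height. The recurrence holds because
  \<open>(1 - z\<^sup>2)\<^sup>j\<^sup>+\<^sup>1 z\<^sup>m\<^sup>+\<^sup>1\<close> vanishes at both ends.
\<close>

lemma integral_beta_recurrence:
  defines "A \<equiv> \<lambda>j m. \<integral>z. (1 - z\<^sup>2) ^ j * z ^ m \<partial>unif (- 1) 1"
  shows "even m \<Longrightarrow> A 0 m = 1 / real (m + 1)"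
    and "odd m \<Longrightarrow> A j m = 0"
    and "real (m + 1) * A (j + 1) m = 2 * real (j + 1) * A j (m + 2)"
proof -
  have le: "- 1 < (1 :: real)" by simp
  have int: "integrable (unif (- 1) 1) (\<lambda>z. (1 - z\<^sup>2) ^ j * z ^ m)" for j m
    by (intro integrable_unif le continuous_intros)
  have pow: "((\<lambda>x. x ^ (m + 1) / real (m + 1)) has_real_derivative x ^ m) (at x)" for m x
    using DERIV_cdivide[OF DERIV_pow[of "m + 1" x], of "real (m + 1)"] by simp
  have A0: "A 0 m = (1 ^ (m + 1) / real (m + 1) - (- 1) ^ (m + 1) / real (m + 1)) / (1 - (- 1))" for m
    unfolding A_def
    by (rule integral_unif_FTC[OF le], intro continuous_intros) (use pow[of m] in simp)
  show "even m \<Longrightarrow> A 0 m = 1 / real (m + 1)" by (simp add: A0 field_simps)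
  show rec: "real (m + 1) * A (j + 1) m = 2 * real (j + 1) * A j (m + 2)" for j m
  proof -
    have "(\<integral>z. real (m + 1) * ((1 - z\<^sup>2) ^ (j + 1) * z ^ m)
              - 2 * real (j + 1) * ((1 - z\<^sup>2) ^ j * z ^ (m + 2)) \<partial>unif (- 1) 1)
       = ((1 - 1\<^sup>2) ^ (j + 1) * 1 ^ (m + 1) - (1 - (- 1)\<^sup>2) ^ (j + 1) * (- 1) ^ (m + 1)) / (1 - (- 1))"
    proof (rule integral_unif_FTC[OF le])
      fix z :: real
      have "((\<lambda>z. 1 - z\<^sup>2) has_real_derivative - (2 * z)) (at z)"
        by (auto intro!: derivative_eq_intros)
      from DERIV_mult[OF DERIV_power[OF this, of "j + 1"] DERIV_pow[of "m + 1" z]]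
      show "((\<lambda>z. (1 - z\<^sup>2) ^ (j + 1) * z ^ (m + 1)) has_real_derivative
          real (m + 1) * ((1 - z\<^sup>2) ^ (j + 1) * z ^ m)
              - 2 * real (j + 1) * ((1 - z\<^sup>2) ^ j * z ^ (m + 2))) (at z)"
        by (rule DERIV_cong) (simp add: mult_ac)
    qed (intro continuous_intros)
    then show ?thesis
      using int[of "j + 1" m] int[of j "m + 2"]
      by (simp add: A_def del: power_Suc add_2_eq_Suc' of_nat_add of_nat_Suc)
  qed
  show "odd m \<Longrightarrow> A j m = 0"
  proof (induction j arbitrary: m)
    case 0
    then show ?case by (simp add: A0)
  next
    case (Suc j)
    then show ?case using rec[of m j] by simp
  qed
qed

lemma choose_Suc_times: "(n choose Suc k) * Suc k = (n choose k) * (n - k)"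
  by (cases "k \<le> n")
     (metis binomial_absorption binomial_absorb_comp mult.commute, simp add: binomial_eq_0)

lemma integral_pair_mult:
  fixes f :: "'b \<Rightarrow> real" and g :: "'c \<Rightarrow> real"
  assumes "prob_space M" "prob_space N" and f: "integrable M f" and g: "integrable N g"
  shows "integrable (M \<Otimes>\<^sub>M N) (\<lambda>\<omega>. f (fst \<omega>) * g (snd \<omega>))"
    and "(\<integral>\<omega>. f (fst \<omega>) * g (snd \<omega>) \<partial>(M \<Otimes>\<^sub>M N)) = integral\<^sup>L M f * integral\<^sup>L N g"
proof -
  interpret M: prob_space M by fact
  interpret N: prob_space N by fact
  interpret pair_prob_space M N ..
  have [measurable]: "f \<in> borel_measurable M" "g \<in> borel_measurable N"
    using f g by auto
  show int: "integrable (M \<Otimes>\<^sub>M N) (\<lambda>\<omega>. f (fst \<omega>) * g (snd \<omega>))"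
    using f g by (intro Fubini_integrable) (auto simp: abs_mult)
  have "(\<integral>\<omega>. f (fst \<omega>) * g (snd \<omega>) \<partial>(M \<Otimes>\<^sub>M N)) = (\<integral>x. \<integral>y. f x * g y \<partial>N \<partial>M)"
    using integral_fst'[OF int] by simp
  then show "(\<integral>\<omega>. f (fst \<omega>) * g (snd \<omega>) \<partial>(M \<Otimes>\<^sub>M N)) = integral\<^sup>L M f * integral\<^sup>L N g"
    by simp
qed

text \<open>
  Archimedes' hat-box theorem in terms of moments: if the height is uniform on \<open>[-1, 1]\<close> and
  independent of the uniform longitude, then the point is uniform on the unit sphere, and its
  inner product with \<open>(a, b, c)\<close> is uniform on an interval whose half-length is the norm of \<open>(a, b, c)\<close>;
  the right-hand side lists the moments of that uniform law. The binomial expansion separates height and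
  longitude, and parity removes every term unless \<open>N = 2 n\<close> and the index is \<open>2 j\<close>. By the two
  recurrences, the quotient of consecutive remaining terms is the quotient of consecutive terms of
  the binomial expansion of \<open>((a\<^sup>2 + b\<^sup>2) + c\<^sup>2)\<^sup>n\<close>.
\<close>

lemma sphere_moment:
  fixes a b c :: real
  shows "(\<integral>\<omega>. (sqrt (1 - (fst \<omega>)\<^sup>2) * (a * cos (snd \<omega>) + b * sin (snd \<omega>)) + c * fst \<omega>) ^ N
            \<partial>(unif (- 1) 1 \<Otimes>\<^sub>M unif 0 (2 * pi)))
       = (if even N then sqrt (a\<^sup>2 + b\<^sup>2 + c\<^sup>2) ^ N / real (N + 1) else 0)"
    (is "?L = ?R")
proof -
  define J where "J k = (\<integral>\<phi>. (a * cos \<phi> + b * sin \<phi>) ^ k \<partial>unif 0 (2 * pi))" for k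
  define A where "A j m = (\<integral>z. (1 - z\<^sup>2) ^ j * z ^ m \<partial>unif (- 1) 1)" for j m
  note J = integral_trig_power_recurrence[where a = a and b = b, folded J_def]
  note A = integral_beta_recurrence[folded A_def]
  let ?s = "\<lambda>z :: real. sqrt (1 - z\<^sup>2)"
  define T where "T k = real (N choose k) * c ^ (N - k) * (\<integral>z. ?s z ^ k * z ^ (N - k) \<partial>unif (- 1) 1) * J k"
    for k
  have odd0: "J (2 * j + 1) = 0" for j
  proof (induction j)
    case (Suc j)
    have "2 * Suc j + 1 = (2 * j + 1) + 2" by simp
    then show ?case using Suc J(3)[of "2 * j + 1"] by (metis mult_eq_0_iff of_nat_eq_0_iff add_2_eq_Suc' nat.simps(3))
  qed (use J(2) in simp)
  have sA: "(\<integral>z. ?s z ^ (2 * j) * z ^ m \<partial>unif (- 1) 1) = A j m" for j m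
    unfolding A_def
  proof (rule integral_cong_AE)
    show "AE z in unif (- 1) 1. ?s z ^ (2 * j) * z ^ m = (1 - z\<^sup>2) ^ j * z ^ m"
      by (rule eventually_mono[OF AE_unif]) (auto simp: power_mult abs_square_le_1 abs_le_iff)
  qed measurable
  have "?L = (\<integral>\<omega>. (\<Sum>k\<le>N. (real (N choose k) * c ^ (N - k) * (?s (fst \<omega>) ^ k * fst \<omega> ^ (N - k)))
                 * (a * cos (snd \<omega>) + b * sin (snd \<omega>)) ^ k)
               \<partial>(unif (- 1) 1 \<Otimes>\<^sub>M unif 0 (2 * pi)))"
    by (intro Bochner_Integration.integral_cong refl, subst binomial_ring)
       (simp add: power_mult_distrib mult_ac)
  also have "\<dots> = (\<Sum>k\<le>N. T k)"
  proof -
    let ?g = "\<lambda>k \<omega>. (real (N choose k) * c ^ (N - k) * (?s (fst \<omega>) ^ k * fst \<omega> ^ (N - k)))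
                 * (a * cos (snd \<omega>) + b * sin (snd \<omega>)) ^ k"
    have "integrable (unif (- 1) 1 \<Otimes>\<^sub>M unif 0 (2 * pi)) (?g k)"
      and "integral\<^sup>L (unif (- 1) 1 \<Otimes>\<^sub>M unif 0 (2 * pi)) (?g k) = T k" for k
    proof -
      have "integrable (unif (- 1) 1) (\<lambda>z. real (N choose k) * c ^ (N - k) * (?s z ^ k * z ^ (N - k)))"
        and "integrable (unif 0 (2 * pi)) (\<lambda>\<phi>. (a * cos \<phi> + b * sin \<phi>) ^ k)"
        by (intro integrable_unif continuous_intros; simp)+
      note P = integral_pair_mult[OF prob_space_unif prob_space_unif this]
      show "integrable (unif (- 1) 1 \<Otimes>\<^sub>M unif 0 (2 * pi)) (?g k)"
        by (rule P(1)) auto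
      show "integral\<^sup>L (unif (- 1) 1 \<Otimes>\<^sub>M unif 0 (2 * pi)) (?g k) = T k"
        by (subst P(2)) (simp_all add: T_def J_def)
    qed
    then show ?thesis by (subst Bochner_Integration.integral_sum) auto
  qed
  also have "\<dots> = ?R"
  proof (cases "even N")
    case False
    have "T k = 0" if "k \<le> N" for k
    proof (cases "even k")
      case True
      then obtain j where k: "k = 2 * j" by blast
      have "odd (N - k)" using False True that by simp
      then show ?thesis by (simp add: T_def k sA A(2))
    next
      case odd: False
      then obtain j where "k = 2 * j + 1" using oddE by blast
      then show ?thesis using odd0[of j] by (simp add: T_def)
    qed
    then show ?thesis using False by simp
  next
    case True
    then obtain n where N: "N = 2 * n" by blast
    let ?r = "a\<^sup>2 + b\<^sup>2"
    have closed: "real (2 * n choose (2 * j)) * A j (2 * n - 2 * j) * J (2 * j)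
        = real (n choose j) * ?r ^ j / real (2 * n + 1)" if "j \<le> n" for j
      using that
    proof (induction j)
      case 0
      then show ?case using A(1)[of "2 * n"] J(1) by simp
    next
      case (Suc j)
      define m where "m = 2 * n - 2 * Suc j"
      have m: "2 * n - 2 * j = m + 2" "real n - real j = real (m + 2) / 2"
        using Suc.prems by (auto simp: m_def)
      have A': "A (Suc j) m = 2 * real (j + 1) * A j (m + 2) / real (m + 1)"
        using A(3)[of m j] by (simp add: field_simps)
      have J': "J (2 * Suc j) = real (2 * j + 1) * ?r * J (2 * j) / real (2 * j + 2)"
        using J(3)[of "2 * j"] by (simp add: field_simps)
      have "real (2 * n choose (2 * Suc j)) * (real (2 * j + 1) * real (2 * j + 2))
          = real (2 * n choose (2 * j)) * (real (m + 2) * real (m + 1))"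
      proof -
        have "(2 * n choose Suc (Suc (2 * j))) * (Suc (2 * j) * Suc (Suc (2 * j)))
            = (2 * n choose Suc (2 * j)) * Suc (2 * j) * (2 * n - Suc (2 * j))"
          using choose_Suc_times[of "2 * n" "Suc (2 * j)"] by (simp only: mult_ac)
        also have "\<dots> = (2 * n choose (2 * j)) * ((m + 2) * (m + 1))"
        proof -
          have "2 * n - Suc (2 * j) = m + 1" using m(1) by simp
          then show ?thesis by (simp only: choose_Suc_times[of "2 * n" "2 * j"] m(1) mult.assoc)
        qed
        finally have "(2 * n choose (2 * Suc j)) * ((2 * j + 1) * (2 * j + 2))
            = (2 * n choose (2 * j)) * ((m + 2) * (m + 1))"
          by (simp only: mult_Suc_right add_2_eq_Suc add_2_eq_Suc' Suc_eq_plus1[symmetric])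
        then show ?thesis by (metis of_nat_mult)
      qed
      then have C': "real (2 * n choose (2 * Suc j))
          = real (2 * n choose (2 * j)) * (real (m + 2) * real (m + 1)) / (real (2 * j + 1) * real (2 * j + 2))"
        by (simp add: field_simps del: of_nat_add of_nat_Suc of_nat_mult)
      have "real (n choose Suc j) * real (Suc j) = real (n choose j) * real (n - j)"
        using choose_Suc_times[of n j] by (metis of_nat_mult)
      then have c': "real (n choose Suc j) = real (n choose j) * (real (m + 2) / 2) / real (j + 1)"
        using Suc.prems m(2) by (simp add: of_nat_diff field_simps)
      have "real (2 * n choose (2 * Suc j)) * A (Suc j) m * J (2 * Suc j)
          = (real (2 * n choose (2 * j)) * A j (m + 2) * J (2 * j)) * (real (m + 2) * ?r / real (2 * j + 2))"
        unfolding A' J' C' by (simp add: field_simps del: of_nat_add of_nat_Suc of_nat_mult) (simp add: field_simps)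
      also have "\<dots> = real (n choose Suc j) * ?r ^ Suc j / real (2 * n + 1)"
      proof -
        have "real (2 * n choose (2 * j)) * A j (m + 2) * J (2 * j)
            = real (n choose j) * ?r ^ j / real (2 * n + 1)"
          using Suc m(1) by simp
        moreover have "real (2 * j + 2) = 2 * real (j + 1)" by simp
        ultimately show ?thesis
          unfolding c' by (simp only: power_Suc times_divide_eq_left times_divide_eq_right
              divide_divide_eq_left divide_divide_eq_right mult_ac)
      qed
      finally show ?case unfolding m_def .
    qed
    have "(\<Sum>k\<le>N. T k) = (\<Sum>k\<in>(\<lambda>j. 2 * j) ` {..n}. T k)"
    proof (rule sum.mono_neutral_right)
      show "\<forall>k\<in>{..N} - (\<lambda>j. 2 * j) ` {..n}. T k = 0"
      proof
        fix k assume k: "k \<in> {..N} - (\<lambda>j. 2 * j) ` {..n}"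
        have "odd k" using k N by (auto elim!: evenE)
        then obtain j where "k = 2 * j + 1" using oddE by blast
        then show "T k = 0" using odd0[of j] by (simp add: T_def)
      qed
    qed (auto simp: N)
    also have "\<dots> = (\<Sum>j\<le>n. T (2 * j))"
      by (subst sum.reindex) (auto simp: inj_on_def)
    also have "\<dots> = (\<Sum>j\<le>n. real (n choose j) * ?r ^ j * (c\<^sup>2) ^ (n - j)) / real (N + 1)"
      unfolding sum_divide_distrib
    proof (rule sum.cong[OF refl])
      fix j assume "j \<in> {..n}"
      then have j: "j \<le> n" by simp
      have "T (2 * j) = (real (2 * n choose (2 * j)) * A j (2 * n - 2 * j) * J (2 * j)) * c ^ (2 * (n - j))"
        unfolding T_def N sA by (simp add: mult_ac diff_mult_distrib)
      then show "T (2 * j) = real (n choose j) * ?r ^ j * (c\<^sup>2) ^ (n - j) / real (N + 1)"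
        unfolding closed[OF j] by (simp add: N power_mult)
    qed
    also have "\<dots> = (a\<^sup>2 + b\<^sup>2 + c\<^sup>2) ^ n / real (N + 1)"
      by (simp add: binomial_ring)
    finally show ?thesis by (simp add: N power_mult)
  qed
  finally show ?thesis .
qed

section \<open>The one-dimensional law and the law of the radius\<close>

text \<open>
  For \<open>u\<close> uniform on \<open>[-1, 1]\<close>, this is an interpolation between quantile functions: it is odd,
  linear in \<open>t\<close>, and on \<open>[0, 1]\<close> it is \<open>u\<close> with an additional slope \<open>t\<close> beyond \<open>1/2\<close>. Being convex
  on \<open>[0, 1]\<close>, it describes a law that is unimodal at \<open>0\<close>.
\<close>

definition spread :: "real \<Rightarrow> real \<Rightarrow> real" where
  "spread t u = u + t * (max (u - 1/2) 0 + min (u + 1/2) 0)"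

lemma continuous_spread: "continuous_on UNIV (spread t)"
  unfolding spread_def by (intro continuous_intros)

lemma borel_measurable_spread [measurable]: "spread t \<in> borel_measurable borel"
  by (rule borel_measurable_continuous_onI[OF continuous_spread])

lemma has_integral_affine_power:
  fixes \<alpha> \<beta> :: real
  assumes "a \<le> b" and "\<alpha> \<noteq> 0"
  shows "((\<lambda>u. (\<alpha> * u + \<beta>) ^ N) has_integral
     ((\<alpha> * b + \<beta>) ^ (N + 1) / (\<alpha> * real (N + 1)) - (\<alpha> * a + \<beta>) ^ (N + 1) / (\<alpha> * real (N + 1)))) {a..b}"
proof (rule fundamental_theorem_of_calculus[OF assms(1)])
  fix x
  have "((\<lambda>u. \<alpha> * u + \<beta>) has_real_derivative \<alpha>) (at x within {a..b})"
    by (auto intro!: derivative_eq_intros)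
  from DERIV_cdivide[OF DERIV_power[OF this, of "N + 1"], of "\<alpha> * real (N + 1)"]
  show "((\<lambda>u. (\<alpha> * u + \<beta>) ^ (N + 1) / (\<alpha> * real (N + 1))) has_vector_derivative (\<alpha> * x + \<beta>) ^ N) (at x within {a..b})"
    using assms(2) unfolding has_real_derivative_iff_has_vector_derivative[symmetric]
    by (elim DERIV_cong) (simp del: of_nat_Suc)
qed

lemma spread_moment:
  assumes t: "0 \<le> t"
  shows "(\<integral>u. spread t u ^ N \<partial>unif (- 1) 1)
       = (if even N then ((1/2) ^ (N + 1) * (t / (1 + t)) + (1 + t/2) ^ (N + 1) / (1 + t)) / real (N + 1) else 0)"
proof -
  let ?P = "\<lambda>x :: real. x ^ (N + 1)" and ?n = "real (N + 1)"
  have pos: "1 + t \<noteq> 0" using t by simp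
  have left: "((\<lambda>u. spread t u ^ N) has_integral
      (?P (- 1/2) / ((1 + t) * ?n) - ?P (- (1 + t/2)) / ((1 + t) * ?n))) {- 1 .. - 1/2}"
  proof (rule has_integral_eq[rotated])
    show "((\<lambda>u. ((1 + t) * u + t/2) ^ N) has_integral
      (?P (- 1/2) / ((1 + t) * ?n) - ?P (- (1 + t/2)) / ((1 + t) * ?n))) {- 1 .. - 1/2}"
    proof -
      have e: "(1 + t) * (- 1) + t/2 = - (1 + t/2)" "(1 + t) * (- 1/2) + t/2 = - 1/2"
        by (simp_all add: field_simps)
      show ?thesis
        using has_integral_affine_power[where a = "- 1" and b = "- 1/2" and \<alpha> = "1 + t" and \<beta> = "t/2" and N = N] pos
        unfolding e by simp
    qed
    fix u :: real assume "u \<in> {- 1 .. - 1/2}"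
    then have "max (u - 1/2) 0 = 0" "min (u + 1/2) 0 = u + 1/2" by auto
    then show "((1 + t) * u + t/2) ^ N = spread t u ^ N"
      by (simp only: spread_def) (simp add: algebra_simps)
  qed
  have mid: "((\<lambda>u. spread t u ^ N) has_integral (?P (1/2) / ?n - ?P (- 1/2) / ?n)) {- 1/2 .. 1/2}"
  proof (rule has_integral_eq[rotated])
    show "((\<lambda>u. (1 * u + 0) ^ N) has_integral (?P (1/2) / ?n - ?P (- 1/2) / ?n)) {- 1/2 .. 1/2}"
      using has_integral_affine_power[where a = "- 1/2" and b = "1/2" and \<alpha> = 1 and \<beta> = 0 and N = N]
      by simp
  qed (auto simp: spread_def max_absorb2 min_absorb2)
  have right: "((\<lambda>u. spread t u ^ N) has_integral
      (?P (1 + t/2) / ((1 + t) * ?n) - ?P (1/2) / ((1 + t) * ?n))) {1/2 .. 1}"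
  proof (rule has_integral_eq[rotated])
    show "((\<lambda>u. ((1 + t) * u + (- t/2)) ^ N) has_integral
      (?P (1 + t/2) / ((1 + t) * ?n) - ?P (1/2) / ((1 + t) * ?n))) {1/2 .. 1}"
      using has_integral_affine_power[where a = "1/2" and b = 1 and \<alpha> = "1 + t" and \<beta> = "- t/2" and N = N] pos
      by (simp add: field_simps del: power_Suc)
    fix u :: real assume "u \<in> {1/2 .. 1}"
    then have "max (u - 1/2) 0 = u - 1/2" "min (u + 1/2) 0 = 0" by auto
    then show "((1 + t) * u + (- t/2)) ^ N = spread t u ^ N"
      by (simp only: spread_def) (simp add: algebra_simps)
  qed
  have "((\<lambda>u. spread t u ^ N) has_integral
      ((?P (- 1/2) / ((1 + t) * ?n) - ?P (- (1 + t/2)) / ((1 + t) * ?n)) +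
       (?P (1/2) / ?n - ?P (- 1/2) / ?n) +
       (?P (1 + t/2) / ((1 + t) * ?n) - ?P (1/2) / ((1 + t) * ?n)))) {- 1 .. 1}"
    by (intro has_integral_combine[OF _ _ has_integral_combine[OF _ _ left mid] right]) auto
  then have "(\<integral>u. spread t u ^ N \<partial>unif (- 1) 1) =
      ((?P (- 1/2) / ((1 + t) * ?n) - ?P (- (1 + t/2)) / ((1 + t) * ?n)) +
       (?P (1/2) / ?n - ?P (- 1/2) / ?n) +
       (?P (1 + t/2) / ((1 + t) * ?n) - ?P (1/2) / ((1 + t) * ?n))) / (1 - (- 1))"
    by (intro integral_unif continuous_on_power continuous_spread) auto
  also have "\<dots> = (if even N then ((1/2) ^ (N + 1) * (t / (1 + t)) + (1 + t/2) ^ (N + 1) / (1 + t)) / real (N + 1) else 0)"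
  proof (cases "even N")
    case True
    have neg: "(- x) ^ (N + 1) = - (x ^ (N + 1))" for x :: real using True by simp
    have gen: "((- (x / (s * n)) - - (y / (s * n))) + (x / n - - (x / n)) + (y / (s * n) - x / (s * n))) / (1 - (- 1))
        = (x * ((s - 1) / s) + y / s) / n" if "s \<noteq> 0" "n \<noteq> 0" for x y s n :: real
      using that by (simp add: field_simps)
    have n: "?n \<noteq> 0" by simp
    show ?thesis
      unfolding minus_divide_left[symmetric] neg gen[OF pos n] using True by simp
  next
    case False
    have neg: "(- x) ^ (N + 1) = x ^ (N + 1)" for x :: real using False by simp
    show ?thesis using False t unfolding minus_divide_left[symmetric] neg by simp
  qed
  finally show ?thesis .
qed

text \<open>
  The density of \<open>\<bar>spread t\<bar>\<close> on the half-line is \<open>1\<close> on \<open>[0, 1/2]\<close> and \<open>1 / (1 + t)\<close> on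
  \<open>[1/2, 1 + t/2]\<close>. A sphere of radius \<open>r\<close> projects to the density \<open>1/r\<close> on \<open>[0, r]\<close>, so a
  downward jump at \<open>r\<close> requires a sphere of radius \<open>r\<close> with weight \<open>r\<close> times the jump. The jump
  \<open>t / (1 + t)\<close> at \<open>1/2\<close> gives the weight \<open>t / (2 (1 + t))\<close>.
\<close>

definition radius :: "real \<Rightarrow> real \<Rightarrow> real" where
  "radius t v = (if v \<le> t / (2 * (1 + t)) then 1/2 else 1 + t/2)"

lemma borel_measurable_radius [measurable]: "radius t \<in> borel_measurable borel"
  unfolding radius_def by measurable

lemma prob_radius_small:
  assumes "0 \<le> t" "t \<le> 1"
  shows "measure (unif 0 1) {v. v \<le> t / (2 * (1 + t))} = t / (2 * (1 + t))"
proof -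
  define m where "m = t / (2 * (1 + t))"
  have m: "0 \<le> m" "m \<le> 1" using assms by (auto simp: m_def divide_le_eq)
  then have "{0..1} \<inter> {v. v \<le> m} = {0..m}" by auto
  then show ?thesis using m unfolding unif_def m_def[symmetric]
    by (subst measure_uniform_measure) auto
qed

lemma radius_moment:
  assumes t: "0 \<le> t" "t \<le> 1"
  shows "integrable (unif 0 1) (\<lambda>v. radius t v ^ N)"
    and "(\<integral>v. radius t v ^ N \<partial>unif 0 1)
       = (1/2) ^ N * (t / (2 * (1 + t))) + (1 + t/2) ^ N * ((1 + t/2) / (1 + t))"
proof -
  interpret prob_space "unif 0 1" by (rule prob_space_unif) simp
  let ?A = "{v. v \<le> t / (2 * (1 + t))}"
  have eq: "radius t v ^ N = (1 + t/2) ^ N + ((1/2) ^ N - (1 + t/2) ^ N) * indicator ?A v" for v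
    by (simp add: radius_def)
  have A: "?A \<in> sets (unif 0 1)" by simp
  have intA: "integrable (unif 0 1) (indicat_real ?A)"
    using A by (intro integrable_real_indicator) (auto simp: less_top[symmetric])
  show "integrable (unif 0 1) (\<lambda>v. radius t v ^ N)"
    unfolding eq using intA by (intro Bochner_Integration.integrable_add integrable_mult_right) auto
  have "(\<integral>v. radius t v ^ N \<partial>unif 0 1) = (1 + t/2) ^ N + ((1/2) ^ N - (1 + t/2) ^ N) * prob ?A"
    unfolding eq using A intA
    by (subst Bochner_Integration.integral_add) (auto simp: prob_space[simplified])
  also have "\<dots> = (1/2) ^ N * (t / (2 * (1 + t))) + (1 + t/2) ^ N * ((1 + t/2) / (1 + t))"
  proof -
    have "(1 + t/2) / (1 + t) = 1 - t / (2 * (1 + t))" using t by (simp add: field_simps)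
    moreover have "A + (B - A) * m = B * m + A * (1 - m)" for A B m :: real
      by (simp add: algebra_simps)
    ultimately show ?thesis unfolding prob_radius_small[OF t] by metis
  qed
  finally show "(\<integral>v. radius t v ^ N \<partial>unif 0 1)
       = (1/2) ^ N * (t / (2 * (1 + t))) + (1 + t/2) ^ N * ((1 + t/2) / (1 + t))" .
qed

section \<open>The curve of mixtures of spheres\<close>

lemma AE_pair_fst:
  assumes "prob_space M" "prob_space N" and "AE x in M. P x"
  shows "AE \<omega> in M \<Otimes>\<^sub>M N. P (fst \<omega>)"
proof -
  interpret N: prob_space N by fact
  have "AE x in distr (M \<Otimes>\<^sub>M N) M fst. P x"
    unfolding N.distr_pair_fst by fact
  then show ?thesis by (rule AE_distrD[rotated]) simp
qed

lemma AE_pair_snd: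
  assumes "prob_space M" "prob_space N" and "AE x in N. P x"
  shows "AE \<omega> in M \<Otimes>\<^sub>M N. P (snd \<omega>)"
proof -
  interpret M: prob_space M by fact
  interpret N: prob_space N by fact
  interpret pair_prob_space M N ..
  have "distr (M \<Otimes>\<^sub>M N) N snd = distr (distr (N \<Otimes>\<^sub>M M) (M \<Otimes>\<^sub>M N) (\<lambda>(x, y). (y, x))) N snd"
    by (subst distr_pair_swap) simp
  also have "\<dots> = N"
    by (subst distr_distr) (auto simp: comp_def case_prod_beta M.distr_pair_fst)
  finally have eq: "distr (M \<Otimes>\<^sub>M N) N snd = N" .
  have "AE x in distr (M \<Otimes>\<^sub>M N) N snd. P x"
    unfolding eq by fact
  then show ?thesis by (rule AE_distrD[rotated]) simp
qed

lemma abs_spread_le: "0 \<le> t \<Longrightarrow> \<bar>u\<bar> \<le> 1 \<Longrightarrow> \<bar>spread t u\<bar> \<le> 1 + t/2"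
proof -
  assume t: "0 \<le> t" and u: "\<bar>u\<bar> \<le> 1"
  have "\<bar>max (u - 1/2) 0 + min (u + 1/2) 0\<bar> \<le> 1/2"
    using u by (auto simp: max_def min_def)
  then have "t * \<bar>max (u - 1/2) 0 + min (u + 1/2) 0\<bar> \<le> t * (1/2)"
    using t by (intro mult_left_mono)
  then show ?thesis
    using u t abs_triangle_ineq[of u "t * (max (u - 1/2) 0 + min (u + 1/2) 0)"]
    by (simp add: spread_def abs_mult)
qed

definition angles :: "(real \<times> real) measure" where
  "angles = unif (- 1) 1 \<Otimes>\<^sub>M unif 0 (2 * pi)"

definition base_space :: "(real \<times> real \<times> real) measure" where
  "base_space = unif 0 1 \<Otimes>\<^sub>M angles"

lemma sets_angles [measurable_cong, simp]: "sets angles = sets (borel \<Otimes>\<^sub>M borel)"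
  unfolding angles_def by (intro sets_pair_measure_cong) simp_all

lemma sets_base_space [measurable_cong, simp]: "sets base_space = sets (borel \<Otimes>\<^sub>M (borel \<Otimes>\<^sub>M borel))"
  unfolding base_space_def by (intro sets_pair_measure_cong) simp_all

lemma prob_space_angles: "prob_space angles"
proof -
  interpret A: prob_space "unif (- 1) 1" by (rule prob_space_unif) simp
  interpret B: prob_space "unif 0 (2 * pi)" by (rule prob_space_unif) simp
  interpret pair_prob_space "unif (- 1) 1" "unif 0 (2 * pi)" ..
  show ?thesis unfolding angles_def by (rule prob_space_axioms)
qed

lemma prob_space_base_space: "prob_space base_space"
proof -
  interpret A: prob_space "unif 0 1" by (rule prob_space_unif) simp
  interpret B: prob_space angles by (rule prob_space_angles)
  interpret pair_prob_space "unif 0 1" angles ..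
  show ?thesis unfolding base_space_def by (rule prob_space_axioms)
qed

lemma AE_angles: "AE \<omega> in angles. \<bar>fst \<omega>\<bar> \<le> 1"
proof -
  have "AE z in unif (- 1) 1. \<bar>z\<bar> \<le> 1"
    by (rule eventually_mono[OF AE_unif]) auto
  then show ?thesis
    unfolding angles_def by (intro AE_pair_fst prob_space_unif) auto
qed

text \<open>
  The spheres lie in the span of \<open>e1\<close>, \<open>e2\<close>, \<open>e3\<close>. Three dimensions are chosen because there the
  projections of a sphere are uniform. In every larger space, a slice only sees the orthogonal
  projection of its direction to this span, and \<open>proj_norm\<close> is the length of that projection.
\<close>

locale orthonormal_triple =
  fixes e1 e2 e3 :: "'a::euclidean_space"
  assumes unit: "e1 \<bullet> e1 = 1" "e2 \<bullet> e2 = 1" "e3 \<bullet> e3 = 1"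
    and orth: "e1 \<bullet> e2 = 0" "e1 \<bullet> e3 = 0" "e2 \<bullet> e3 = 0"
begin

definition direction :: "real \<times> real \<Rightarrow> 'a" where
  "direction \<omega> = (sqrt (1 - (fst \<omega>)\<^sup>2) * cos (snd \<omega>)) *\<^sub>R e1
     + (sqrt (1 - (fst \<omega>)\<^sup>2) * sin (snd \<omega>)) *\<^sub>R e2 + fst \<omega> *\<^sub>R e3"

definition position :: "real \<Rightarrow> real \<times> real \<times> real \<Rightarrow> 'a" where
  "position t \<omega> = radius t (fst \<omega>) *\<^sub>R direction (snd \<omega>)"

definition mixture :: "real \<Rightarrow> 'a measure" where
  "mixture t = distr base_space borel (position t)"

definition proj_norm :: "'a \<Rightarrow> real" where
  "proj_norm \<theta> = sqrt ((\<theta> \<bullet> e1)\<^sup>2 + (\<theta> \<bullet> e2)\<^sup>2 + (\<theta> \<bullet> e3)\<^sup>2)"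

lemma proj_norm_nonneg: "0 \<le> proj_norm \<theta>"
  by (simp add: proj_norm_def)

lemma measurable_direction [measurable]: "direction \<in> borel_measurable angles"
  unfolding direction_def by measurable

lemma measurable_position [measurable]: "position t \<in> borel_measurable base_space"
  unfolding position_def direction_def by measurable

lemma norm_direction: "\<bar>fst \<omega>\<bar> \<le> 1 \<Longrightarrow> norm (direction \<omega>) = 1"
proof -
  assume "\<bar>fst \<omega>\<bar> \<le> 1"
  then have "(fst \<omega>)\<^sup>2 \<le> 1" by (simp add: abs_square_le_1)
  then have s: "(sqrt (1 - (fst \<omega>)\<^sup>2))\<^sup>2 = 1 - (fst \<omega>)\<^sup>2" by simp
  have "(x *\<^sub>R e1 + y *\<^sub>R e2 + z *\<^sub>R e3) \<bullet> (x *\<^sub>R e1 + y *\<^sub>R e2 + z *\<^sub>R e3) = x\<^sup>2 + y\<^sup>2 + z\<^sup>2" for x y z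
    by (simp add: inner_add_left inner_add_right unit orth inner_commute[of e2 e1]
        inner_commute[of e3 e1] inner_commute[of e3 e2] power2_eq_square)
  then have "direction \<omega> \<bullet> direction \<omega>
      = (1 - (fst \<omega>)\<^sup>2) * ((cos (snd \<omega>))\<^sup>2 + (sin (snd \<omega>))\<^sup>2) + (fst \<omega>)\<^sup>2"
    by (simp only: direction_def power_mult_distrib s distrib_left)
  also have "\<dots> = 1" by simp
  finally show ?thesis by (simp add: norm_eq_1)
qed

lemma AE_norm_position: "AE \<omega> in base_space. norm (position t \<omega>) = radius t (fst \<omega>)" if "0 \<le> t"
proof -
  have "AE \<omega> in base_space. \<bar>fst (snd \<omega>)\<bar> \<le> 1"
    unfolding base_space_def
    by (intro AE_pair_snd[where P = "\<lambda>\<omega>. \<bar>fst \<omega>\<bar> \<le> 1"] prob_space_unif prob_space_angles AE_angles) simp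
  then show ?thesis
    using that by (elim eventually_mono) (auto simp: position_def norm_direction radius_def)
qed

lemma radius_bounds: "0 \<le> t \<Longrightarrow> t \<le> 1 \<Longrightarrow> 0 \<le> radius t v \<and> radius t v \<le> 2"
  by (auto simp: radius_def)

text \<open>
  All slices have the same shape: up to the dilation by \<open>proj_norm \<theta>\<close> they are the law of \<open>spread t\<close>.
  Both sides have the same moments, since radius and direction are independent and
  the moments of the projected direction are those of a uniform law.
\<close>

lemma slice_mixture:
  assumes t: "0 \<le> t" "t \<le> 1"
  shows "slice \<theta> (mixture t) = distr (unif (- 1) 1) borel (\<lambda>u. proj_norm \<theta> * spread t u)"
proof -
  interpret U: prob_space "unif (- 1) 1" by (rule prob_space_unif) simp
  interpret A: prob_space angles by (rule prob_space_angles)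
  let ?B = "2 * (norm \<theta> + proj_norm \<theta>)"
  have "distr base_space borel (\<lambda>\<omega>. position t \<omega> \<bullet> \<theta>)
      = distr (unif (- 1) 1) borel (\<lambda>u. proj_norm \<theta> * spread t u)"
  proof (rule distr_eq_of_moments[where B = ?B])
    show "AE \<omega> in base_space. \<bar>position t \<omega> \<bullet> \<theta>\<bar> \<le> ?B"
      using AE_norm_position[OF t(1)]
    proof (rule eventually_mono)
      fix \<omega> assume "norm (position t \<omega>) = radius t (fst \<omega>)"
      then have "norm (position t \<omega>) \<le> 2" using radius_bounds[OF t] by simp
      then have "\<bar>position t \<omega> \<bullet> \<theta>\<bar> \<le> 2 * norm \<theta>"
        using Cauchy_Schwarz_ineq2[of "position t \<omega>" \<theta>]
        by (meson mult_right_mono norm_ge_zero order_trans)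
      then show "\<bar>position t \<omega> \<bullet> \<theta>\<bar> \<le> ?B" using proj_norm_nonneg[of \<theta>] by simp
    qed
    show "AE u in unif (- 1) 1. \<bar>proj_norm \<theta> * spread t u\<bar> \<le> ?B"
      using AE_unif
    proof (rule eventually_mono)
      fix u :: real assume "- 1 \<le> u \<and> u \<le> 1"
      then have "\<bar>spread t u\<bar> \<le> 2" using abs_spread_le[OF t(1), of u] t(2) by (simp add: abs_le_iff)
      then have "proj_norm \<theta> * \<bar>spread t u\<bar> \<le> proj_norm \<theta> * 2"
        by (intro mult_left_mono proj_norm_nonneg)
      also have "\<dots> \<le> ?B" by simp
      finally show "\<bar>proj_norm \<theta> * spread t u\<bar> \<le> ?B"
        using proj_norm_nonneg[of \<theta>] by (simp add: abs_mult)
    qed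
    fix N
    have dir: "direction \<omega> \<bullet> \<theta> = sqrt (1 - (fst \<omega>)\<^sup>2) * (\<theta> \<bullet> e1 * cos (snd \<omega>) + \<theta> \<bullet> e2 * sin (snd \<omega>))
        + \<theta> \<bullet> e3 * fst \<omega>" for \<omega>
      by (simp add: direction_def inner_add_left inner_commute[of \<theta>] algebra_simps)
    have bnd: "AE \<omega> in angles. norm ((direction \<omega> \<bullet> \<theta>) ^ N) \<le> norm \<theta> ^ N"
      using AE_angles
    proof (rule eventually_mono)
      fix \<omega> :: "real \<times> real" assume "\<bar>fst \<omega>\<bar> \<le> 1"
      then have "\<bar>direction \<omega> \<bullet> \<theta>\<bar> \<le> norm \<theta>"
        using Cauchy_Schwarz_ineq2[of "direction \<omega>" \<theta>] by (simp add: norm_direction)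
      then show "norm ((direction \<omega> \<bullet> \<theta>) ^ N) \<le> norm \<theta> ^ N"
        by (simp add: power_abs power_mono)
    qed
    have int: "integrable angles (\<lambda>\<omega>. (direction \<omega> \<bullet> \<theta>) ^ N)"
      using bnd by (rule A.integrable_const_bound) measurable
    have "(\<integral>\<omega>. (position t \<omega> \<bullet> \<theta>) ^ N \<partial>base_space)
        = (\<integral>\<omega>. radius t (fst \<omega>) ^ N * (direction (snd \<omega>) \<bullet> \<theta>) ^ N \<partial>(unif 0 1 \<Otimes>\<^sub>M angles))"
      by (simp add: base_space_def position_def power_mult_distrib)
    also have "\<dots> = (\<integral>v. radius t v ^ N \<partial>unif 0 1) * (\<integral>\<omega>. (direction \<omega> \<bullet> \<theta>) ^ N \<partial>angles)"
      by (intro integral_pair_mult(2) prob_space_unif prob_space_angles int radius_moment(1) t) simp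
    also have "(\<integral>\<omega>. (direction \<omega> \<bullet> \<theta>) ^ N \<partial>angles) = (if even N then proj_norm \<theta> ^ N / real (N + 1) else 0)"
      unfolding dir angles_def sphere_moment proj_norm_def ..
    also have "(\<integral>v. radius t v ^ N \<partial>unif 0 1) * \<dots> = proj_norm \<theta> ^ N * (\<integral>u. spread t u ^ N \<partial>unif (- 1) 1)"
    proof -
      have "(1/2) ^ (N + 1) * (t / (1 + t)) + (1 + t/2) ^ (N + 1) / (1 + t)
          = (1/2) ^ N * (t / (2 * (1 + t))) + (1 + t/2) ^ N * ((1 + t/2) / (1 + t))"
        by simp
      then show ?thesis
        unfolding spread_moment[OF t(1)] radius_moment(2)[OF t] by simp
    qed
    also have "\<dots> = (\<integral>u. (proj_norm \<theta> * spread t u) ^ N \<partial>unif (- 1) 1)"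
      by (simp add: power_mult_distrib)
    finally show "(\<integral>\<omega>. (position t \<omega> \<bullet> \<theta>) ^ N \<partial>base_space)
        = (\<integral>u. (proj_norm \<theta> * spread t u) ^ N \<partial>unif (- 1) 1)" .
  qed (use prob_space_base_space U.prob_space_axioms in auto)
  then show ?thesis
    unfolding slice_def mixture_def by (subst distr_distr) (auto simp: comp_def)
qed

end

section \<open>Estimating Wasserstein distances by random variables and couplings\<close>

lemma borel_measurable_dist_pair:
  fixes P :: real
  shows "(\<lambda>(x, y). dist x y) \<in> borel_measurable (borel :: ('a::euclidean_space \<times> 'a) measure)"
    and "(\<lambda>(x, y). ennreal (dist x y)) \<in> borel_measurable (borel :: ('a::euclidean_space \<times> 'a) measure)"
    and "(\<lambda>(x, y). ennreal (dist x y powr P)) \<in> borel_measurable (borel :: ('a::euclidean_space \<times> 'a) measure)"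
proof -
  have "continuous_on UNIV (\<lambda>z :: 'a \<times> 'a. dist (fst z) (snd z))"
    by (intro continuous_intros)
  then have d: "(\<lambda>z :: 'a \<times> 'a. dist (fst z) (snd z)) \<in> borel_measurable borel"
    by (rule borel_measurable_continuous_onI)
  then show "(\<lambda>(x, y). dist x y) \<in> borel_measurable (borel :: ('a \<times> 'a) measure)"
    by (simp add: case_prod_beta)
  show "(\<lambda>(x, y). ennreal (dist x y)) \<in> borel_measurable (borel :: ('a \<times> 'a) measure)"
    unfolding case_prod_beta by (rule measurable_compose[OF d measurable_ennreal])
  have "(\<lambda>r. ennreal (r powr P)) \<in> borel_measurable borel"
    by measurable
  then show "(\<lambda>(x, y). ennreal (dist x y powr P)) \<in> borel_measurable (borel :: ('a \<times> 'a) measure)"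
    unfolding case_prod_beta by (rule measurable_compose[OF d])
qed

lemma distr_Pair_in_couplings:
  fixes X Y :: "'b \<Rightarrow> 'a::euclidean_space"
  assumes M [measurable]: "prob_space M" "X \<in> borel_measurable M" "Y \<in> borel_measurable M"
  shows "distr M borel (\<lambda>\<omega>. (X \<omega>, Y \<omega>)) \<in> couplings (distr M borel X) (distr M borel Y)"
proof -
  interpret prob_space M by fact
  have [measurable]: "(\<lambda>\<omega>. (X \<omega>, Y \<omega>)) \<in> borel_measurable M"
    by (rule borel_measurable_Pair) auto
  have [measurable]: "fst \<in> borel_measurable (borel :: ('a \<times> 'a) measure)"
    "snd \<in> borel_measurable (borel :: ('a \<times> 'a) measure)"
    by (auto intro!: borel_measurable_continuous_onI continuous_intros)
  show ?thesis
    unfolding couplings_def by (auto simp: distr_distr comp_def intro!: prob_space_distr)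
qed

lemma couplingsD:
  fixes \<gamma> :: "('a::euclidean_space \<times> 'a) measure"
  assumes "\<gamma> \<in> couplings \<mu> \<nu>"
  shows "prob_space \<gamma>" "fst \<in> borel_measurable \<gamma>" "snd \<in> borel_measurable \<gamma>"
    "distr \<gamma> borel fst = \<mu>" "distr \<gamma> borel snd = \<nu>" "(\<lambda>(x, y). dist x y) \<in> borel_measurable \<gamma>"
proof -
  have s: "sets \<gamma> = sets borel" using assms by (simp add: couplings_def)
  have "fst \<in> borel_measurable (borel :: ('a \<times> 'a) measure)"
    "snd \<in> borel_measurable (borel :: ('a \<times> 'a) measure)"
    by (auto intro!: borel_measurable_continuous_onI continuous_intros)
  note meas = this borel_measurable_dist_pair(1)[where 'a = 'a]
  show "fst \<in> borel_measurable \<gamma>" "snd \<in> borel_measurable \<gamma>" "(\<lambda>(x, y). dist x y) \<in> borel_measurable \<gamma>"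
    using meas unfolding measurable_cong_sets[OF s refl] by auto
qed (use assms in \<open>auto simp: couplings_def\<close>)

lemma transport_cost_le:
  fixes X Y :: "'b \<Rightarrow> 'a::euclidean_space"
  assumes M: "prob_space M" "X \<in> borel_measurable M" "Y \<in> borel_measurable M"
  shows "(INF \<gamma> \<in> couplings (distr M borel X) (distr M borel Y).
      \<integral>\<^sup>+ (x, y). ennreal (dist x y powr P) \<partial>\<gamma>) \<le> (\<integral>\<^sup>+ \<omega>. ennreal (dist (X \<omega>) (Y \<omega>) powr P) \<partial>M)"
proof -
  have "(INF \<gamma> \<in> couplings (distr M borel X) (distr M borel Y).
      \<integral>\<^sup>+ (x, y). ennreal (dist x y powr P) \<partial>\<gamma>)
      \<le> (\<integral>\<^sup>+ (x, y). ennreal (dist x y powr P) \<partial>distr M borel (\<lambda>\<omega>. (X \<omega>, Y \<omega>)))"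
    by (rule INF_lower[OF distr_Pair_in_couplings[OF M]])
  also have "\<dots> = (\<integral>\<^sup>+ \<omega>. ennreal (dist (X \<omega>) (Y \<omega>) powr P) \<partial>M)"
    using nn_integral_distr[OF borel_measurable_Pair[OF M(2,3)],
        of "\<lambda>(x, y). ennreal (dist x y powr P)"] borel_measurable_dist_pair(3)[of P]
    by simp
  finally show ?thesis .
qed

lemma wasserstein_le:
  fixes X Y :: "'b \<Rightarrow> 'a::euclidean_space"
  assumes M [measurable]: "prob_space M" "X \<in> borel_measurable M" "Y \<in> borel_measurable M"
    and p: "p \<noteq> \<infinity>" "0 < enn2real p" and L: "0 \<le> L"
    and le: "(\<integral>\<^sup>+ \<omega>. ennreal (dist (X \<omega>) (Y \<omega>) powr enn2real p) \<partial>M) \<le> ennreal (L powr enn2real p)"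
  shows "wasserstein p (distr M borel X) (distr M borel Y) \<le> L"
proof -
  let ?I = "INF \<gamma> \<in> couplings (distr M borel X) (distr M borel Y).
      \<integral>\<^sup>+ (x, y). ennreal (dist x y powr enn2real p) \<partial>\<gamma>"
  have "?I \<le> (\<integral>\<^sup>+ \<omega>. ennreal (dist (X \<omega>) (Y \<omega>) powr enn2real p) \<partial>M)"
    by (rule transport_cost_le[OF M])
  also have "\<dots> \<le> ennreal (L powr enn2real p)" by (rule le)
  finally have "enn2real ?I \<le> L powr enn2real p"
    by (rule enn2real_leI[rotated]) simp
  then have "enn2real ?I powr (1 / enn2real p) \<le> (L powr enn2real p) powr (1 / enn2real p)"
    using p by (intro powr_mono2) auto
  then show ?thesis using p L by (simp add: wasserstein_def powr_powr)
qed

text \<open>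
  The bound \<open>B\<close> makes the infimum of the costs finite. Without it, \<^const>\<open>enn2real\<close> could turn an
  infinite infimum into \<open>0\<close>.
\<close>

lemma wasserstein_ge:
  fixes X Y :: "'b \<Rightarrow> 'a::euclidean_space"
  assumes M [measurable]: "prob_space M" "X \<in> borel_measurable M" "Y \<in> borel_measurable M"
    and p: "p \<noteq> \<infinity>" "0 < enn2real p" and L: "0 \<le> L"
    and bnd: "AE \<omega> in M. dist (X \<omega>) (Y \<omega>) \<le> B"
    and ge: "\<And>\<gamma>. \<gamma> \<in> couplings (distr M borel X) (distr M borel Y) \<Longrightarrow>
       ennreal (L powr enn2real p) \<le> (\<integral>\<^sup>+ (x, y). ennreal (dist x y powr enn2real p) \<partial>\<gamma>)"
  shows "L \<le> wasserstein p (distr M borel X) (distr M borel Y)"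
proof -
  interpret prob_space M by fact
  let ?I = "INF \<gamma> \<in> couplings (distr M borel X) (distr M borel Y).
      \<integral>\<^sup>+ (x, y). ennreal (dist x y powr enn2real p) \<partial>\<gamma>"
  have "?I \<le> (\<integral>\<^sup>+ \<omega>. ennreal (dist (X \<omega>) (Y \<omega>) powr enn2real p) \<partial>M)"
    by (rule transport_cost_le[OF M])
  also have "\<dots> \<le> (\<integral>\<^sup>+ \<omega>. ennreal (B powr enn2real p) \<partial>M)"
    using bnd p by (intro nn_integral_mono_AE) (auto elim!: eventually_mono intro!: ennreal_leI powr_mono2)
  also have "\<dots> < \<infinity>" by (simp add: emeasure_space_1)
  finally have fin: "?I < \<infinity>" .
  have "ennreal (L powr enn2real p) \<le> ?I"
    by (rule INF_greatest) (rule ge)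
  then have "L powr enn2real p \<le> enn2real ?I"
    using fin enn2real_mono[of "ennreal (L powr enn2real p)" ?I] by (simp add: top_unique)
  then have "(L powr enn2real p) powr (1 / enn2real p) \<le> enn2real ?I powr (1 / enn2real p)"
    using p by (intro powr_mono2) auto
  then show ?thesis using p L by (simp add: wasserstein_def powr_powr)
qed

lemma wasserstein_infinity_le:
  fixes X Y :: "'b \<Rightarrow> 'a::euclidean_space"
  assumes M [measurable]: "prob_space M" "X \<in> borel_measurable M" "Y \<in> borel_measurable M"
    and L: "0 \<le> L" and bnd: "AE \<omega> in M. dist (X \<omega>) (Y \<omega>) \<le> L"
  shows "wasserstein \<infinity> (distr M borel X) (distr M borel Y) \<le> L"
    and "(INF \<gamma> \<in> couplings (distr M borel X) (distr M borel Y). esssup \<gamma> (\<lambda>(x, y). ennreal (dist x y))) \<le> ennreal L"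
proof -
  have P: "(\<lambda>\<omega>. (X \<omega>, Y \<omega>)) \<in> M \<rightarrow>\<^sub>M borel" by (rule borel_measurable_Pair) auto
  let ?I = "INF \<gamma> \<in> couplings (distr M borel X) (distr M borel Y). esssup \<gamma> (\<lambda>(x, y). ennreal (dist x y))"
  have "?I \<le> esssup (distr M borel (\<lambda>\<omega>. (X \<omega>, Y \<omega>))) (\<lambda>(x, y). ennreal (dist x y))"
    by (rule INF_lower[OF distr_Pair_in_couplings[OF M]])
  also have "\<dots> \<le> ennreal L"
  proof (rule esssup_I)
    show "(\<lambda>(x, y). ennreal (dist x y)) \<in> borel_measurable (distr M borel (\<lambda>\<omega>. (X \<omega>, Y \<omega>)))"
      using borel_measurable_dist_pair(2) by simp
    show "AE z in distr M borel (\<lambda>\<omega>. (X \<omega>, Y \<omega>)). (case z of (x, y) \<Rightarrow> ennreal (dist x y)) \<le> ennreal L"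
    proof (subst AE_distr_iff[OF P])
      have [measurable]: "(\<lambda>z :: 'a \<times> 'a. ennreal (dist (fst z) (snd z))) \<in> borel_measurable borel"
        by (rule borel_measurable_dist_pair(2)[unfolded case_prod_beta])
      show "{z \<in> space borel. (case z of (x :: 'a, y) \<Rightarrow> ennreal (dist x y)) \<le> ennreal L} \<in> sets borel"
        unfolding case_prod_beta by measurable
      show "AE \<omega> in M. (case (X \<omega>, Y \<omega>) of (x, y) \<Rightarrow> ennreal (dist x y)) \<le> ennreal L"
        using bnd by (rule eventually_mono) (auto intro!: ennreal_leI)
    qed
  qed
  finally show "?I \<le> ennreal L" .
  then show "wasserstein \<infinity> (distr M borel X) (distr M borel Y) \<le> L"
    unfolding wasserstein_def if_P[OF refl] by (rule enn2real_leI[OF L])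
qed

lemma wasserstein_infinity_ge:
  fixes X Y :: "'b \<Rightarrow> 'a::euclidean_space"
  assumes M: "prob_space M" "X \<in> borel_measurable M" "Y \<in> borel_measurable M"
    and B: "0 \<le> B" and bnd: "AE \<omega> in M. dist (X \<omega>) (Y \<omega>) \<le> B"
    and ge: "\<And>\<gamma> e. \<gamma> \<in> couplings (distr M borel X) (distr M borel Y) \<Longrightarrow> 0 \<le> e \<Longrightarrow>
       AE (x, y) in \<gamma>. dist x y \<le> e \<Longrightarrow> L \<le> e"
  shows "L \<le> wasserstein \<infinity> (distr M borel X) (distr M borel Y)"
proof -
  define I where "I = (INF \<gamma> \<in> couplings (distr M borel X) (distr M borel Y). esssup \<gamma> (\<lambda>(x, y). ennreal (dist x y)))"
  have "I < \<top>"
    using wasserstein_infinity_le(2)[OF M B bnd] unfolding I_def by (rule le_less_trans) simp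
  then have fin: "I \<noteq> \<top>" by simp
  have "ennreal L \<le> I"
    unfolding I_def
  proof (rule INF_greatest)
    fix \<gamma> assume \<gamma>: "\<gamma> \<in> couplings (distr M borel X) (distr M borel Y)"
    show "ennreal L \<le> esssup \<gamma> (\<lambda>(x, y). ennreal (dist x y))"
    proof (cases "esssup \<gamma> (\<lambda>(x, y). ennreal (dist x y))")
      case (real e)
      have "AE z in \<gamma>. (case z of (x, y) \<Rightarrow> ennreal (dist x y)) \<le> ennreal e"
        using esssup_AE[where M = \<gamma> and f = "\<lambda>(x, y). ennreal (dist x y)"] real by simp
      then have "AE (x, y) in \<gamma>. dist x y \<le> e"
        by (rule eventually_mono) (use real in auto)
      then show ?thesis using ge[OF \<gamma> real(1)] real by (simp add: ennreal_leI)
    qed simp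
  qed
  then have "enn2real (ennreal L) \<le> enn2real I"
    using fin by (intro enn2real_mono) (simp_all add: less_top)
  then have "L \<le> enn2real I"
    by (cases "0 \<le> L") (auto intro: order_trans[OF _ enn2real_nonneg])
  then show ?thesis by (simp add: wasserstein_def I_def)
qed

section \<open>Wasserstein distances between the slices\<close>

text \<open>
  The speed at which the quantile at \<open>u\<close> moves outwards. It vanishes on the inner half of the mass, which
  stays at rest.
\<close>

definition excess :: "real \<Rightarrow> real" where
  "excess u = max (\<bar>u\<bar> - 1/2) 0"

lemma borel_measurable_excess [measurable]: "excess \<in> borel_measurable borel"
  unfolding excess_def by measurable

lemma excess_bounds: "0 \<le> excess u" "\<bar>u\<bar> \<le> 1 \<Longrightarrow> excess u \<le> 1/2"
  by (auto simp: excess_def max_def)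

lemma abs_spread: "0 \<le> t \<Longrightarrow> \<bar>spread t u\<bar> = \<bar>u\<bar> + t * excess u"
proof -
  assume t: "0 \<le> t"
  consider "u \<ge> 1/2" | "u \<le> - 1/2" | "\<bar>u\<bar> < 1/2" by linarith
  then show ?thesis
  proof cases
    case 1
    then have "spread t u = u + t * (u - 1/2)" "excess u = u - 1/2"
      by (simp_all add: spread_def excess_def max_absorb1 min_absorb2)
    then show ?thesis using 1 t by simp
  next
    case 2
    then have *: "spread t u = u + t * (u + 1/2)" "excess u = - (u + 1/2)"
      by (simp_all add: spread_def excess_def max_absorb1 max_absorb2 min_absorb1)
    have "t * (u + 1/2) \<le> 0" using 2 t by (intro mult_nonneg_nonpos) auto
    then have "\<bar>spread t u\<bar> = - (u + t * (u + 1/2))" "\<bar>u\<bar> = - u"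
      using 2 *(1) by auto
    then show ?thesis unfolding *(2) by (simp add: algebra_simps)
  next
    case 3
    then show ?thesis by (simp add: spread_def excess_def max_absorb2 min_absorb2)
  qed
qed

lemma abs_spread_diff: "\<bar>spread s u - spread t u\<bar> = \<bar>t - s\<bar> * excess u"
proof -
  have "spread s u - spread t u = (s - t) * (max (u - 1/2) 0 + min (u + 1/2) 0)"
    by (simp add: spread_def algebra_simps)
  moreover have "\<bar>max (u - 1/2) 0 + min (u + 1/2) 0\<bar> = excess u"
    by (auto simp: excess_def max_def min_def)
  ultimately show ?thesis by (simp add: abs_mult abs_minus_commute)
qed

text \<open>
  The excess can be read off from the position at any time. Therefore the dual potentials below can
  be written as functions of the position.
\<close>

lemma excess_of_spread:
  assumes "0 \<le> c" "0 \<le> t"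
  shows "max (\<bar>c * spread t u\<bar> - c/2) 0 / (1 + t) = c * excess u"
proof -
  have "\<bar>c * spread t u\<bar> - c/2 = c * (\<bar>u\<bar> - 1/2 + t * excess u)"
    using assms by (simp add: abs_mult abs_spread algebra_simps)
  also have "max \<dots> 0 = c * max (\<bar>u\<bar> - 1/2 + t * excess u) 0"
    using assms by (simp add: max_mult_distrib_left)
  also have "max (\<bar>u\<bar> - 1/2 + t * excess u) 0 = (1 + t) * excess u"
  proof (cases "1/2 \<le> \<bar>u\<bar>")
    case True
    then have e: "\<bar>u\<bar> - 1/2 = excess u" by (simp add: excess_def)
    have "0 \<le> (1 + t) * excess u" using assms excess_bounds(1)[of u] by simp
    then show ?thesis unfolding e by (simp add: algebra_simps)
  qed (simp add: excess_def max_absorb2)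
  finally show ?thesis using assms by simp
qed

definition line_law :: "real \<Rightarrow> real \<Rightarrow> real measure" where
  "line_law c t = distr (unif (- 1) 1) borel (\<lambda>u. c * spread t u)"

definition excess_moment :: "real \<Rightarrow> real" where
  "excess_moment P = enn2real (\<integral>\<^sup>+ u. ennreal (excess u powr P) \<partial>unif (- 1) 1)"

lemma nn_integral_excess_powr:
  assumes "0 < P"
  shows "(\<integral>\<^sup>+ u. ennreal (excess u powr P) \<partial>unif (- 1) 1) = ennreal (excess_moment P)"
proof -
  interpret prob_space "unif (- 1) 1" by (rule prob_space_unif) simp
  have "(\<integral>\<^sup>+ u. ennreal (excess u powr P) \<partial>unif (- 1) 1) \<le> (\<integral>\<^sup>+ u. ennreal ((1/2) powr P) \<partial>unif (- 1) 1)"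
    by (intro nn_integral_mono_AE eventually_mono[OF AE_unif])
       (use assms excess_bounds in \<open>auto intro!: ennreal_leI powr_mono2\<close>)
  also have "\<dots> < \<top>" by (simp add: emeasure_space_1[simplified])
  finally show ?thesis by (simp add: excess_moment_def)
qed

lemma powr_ge_tangent:
  fixes a v P :: real
  assumes "0 < a" "0 \<le> v" "1 \<le> P"
  shows "a powr P + P * a powr (P - 1) * (v - a) \<le> v powr P"
proof (cases "v = 0")
  case True
  have "a powr (P - 1) * a = a powr P" using assms powr_mult_base[of a "P - 1"] by (simp add: mult.commute)
  then have "a powr P + P * a powr (P - 1) * (v - a) = (1 - P) * a powr P"
    using True by (simp add: algebra_simps)
  also have "\<dots> \<le> 0" using assms by (intro mult_nonpos_nonneg) auto
  finally show ?thesis by (rule order_trans) simp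
next
  case False
  have "v powr P - a powr P \<ge> P * a powr (P - 1) * (v - a)"
  proof (rule convex_on_imp_above_tangent[where A = "{0<..}"])
    show "convex_on {0<..} (\<lambda>x. x powr P)" using assms by (rule_tac powr_convex) simp
    show "((\<lambda>x. x powr P) has_real_derivative P * a powr (P - 1)) (at a within {0<..})"
      using has_real_derivative_powr[OF assms(1)] by (rule has_field_derivative_at_within)
    show "a \<in> interior {0<..}" using assms(1) by (simp add: interior_open)
    show "v \<in> {0<..}" using assms(2) False by simp
  qed simp
  then show ?thesis by simp
qed

lemma line_law_excess_integral:
  fixes X :: "'b \<Rightarrow> real"
  assumes [measurable]: "X \<in> borel_measurable M" and X: "distr M borel X = line_law c t"
    and c: "0 \<le> c" and t: "0 \<le> t" and P: "0 < P"
  shows "(\<integral>\<^sup>+ \<omega>. ennreal ((max (\<bar>X \<omega>\<bar> - c/2) 0 / (1 + t)) powr P) \<partial>M)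
       = ennreal (c powr P * excess_moment P)"
proof -
  have "(\<integral>\<^sup>+ \<omega>. ennreal ((max (\<bar>X \<omega>\<bar> - c/2) 0 / (1 + t)) powr P) \<partial>M)
      = (\<integral>\<^sup>+ x. ennreal ((max (\<bar>x\<bar> - c/2) 0 / (1 + t)) powr P) \<partial>line_law c t)"
    unfolding X[symmetric] by (subst nn_integral_distr) auto
  also have "\<dots> = (\<integral>\<^sup>+ u. ennreal ((max (\<bar>c * spread t u\<bar> - c/2) 0 / (1 + t)) powr P) \<partial>unif (- 1) 1)"
    unfolding line_law_def by (subst nn_integral_distr) auto
  also have "\<dots> = (\<integral>\<^sup>+ u. ennreal (c powr P) * ennreal (excess u powr P) \<partial>unif (- 1) 1)"
    unfolding excess_of_spread[OF c t]
    by (simp add: powr_mult c excess_bounds ennreal_mult)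
  also have "\<dots> = ennreal (c powr P) * ennreal (excess_moment P)"
    using P by (subst nn_integral_cmult) (auto simp: nn_integral_excess_powr)
  finally show ?thesis by (simp add: ennreal_mult excess_moment_def)
qed

text \<open>
  Weak Kantorovich duality for the monotone transport from time \<open>s\<close> to time \<open>t\<close>. Here \<open>w\<close> and \<open>z\<close>
  are the excesses of the starting point and the end point, and multiples of their \<open>P\<close>-th powers serve as
  potentials. The inequality follows from two tangent inequalities for the convex function \<open>v powr P\<close>:
  at \<open>(t - s) * z\<close>, evaluated at the distance \<open>\<bar>x - y\<bar>\<close>, and at \<open>z\<close>, evaluated at \<open>w\<close>. For points matched by
  the monotone transport, \<open>w = z\<close> and both are equalities.
\<close>

lemma transport_cost_dual_bound:
  fixes c s t P x y :: real
  assumes c: "0 \<le> c" and s: "0 \<le> s" and st: "s < t" and P: "1 \<le> P"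
  defines "w \<equiv> max (\<bar>x\<bar> - c/2) 0 / (1 + s)" and "z \<equiv> max (\<bar>y\<bar> - c/2) 0 / (1 + t)"
  shows "(t - s) powr P * z powr P + (t - s) powr (P - 1) * (1 + s) * z powr P
       \<le> \<bar>x - y\<bar> powr P + (t - s) powr (P - 1) * (1 + s) * w powr P"
proof -
  have w0: "0 \<le> w" and z0: "0 \<le> z" using s st by (auto simp: w_def z_def)
  let ?k = "t - s"
  show ?thesis
  proof (cases "z = 0")
    case True
    then show ?thesis using s by simp
  next
    case False
    then have zp: "0 < z" using z0 by simp
    have y: "\<bar>y\<bar> = c/2 + (1 + t) * z"
      using zp s st by (auto simp: z_def max_def field_simps split: if_splits)
    have "\<bar>x\<bar> - c/2 \<le> (1 + s) * w" using s by (simp add: w_def)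
    then have "(1 + t) * z - (1 + s) * w \<le> \<bar>x - y\<bar>" using y by linarith
    then have dist: "(1 + s) * (z - w) \<le> \<bar>x - y\<bar> - ?k * z" by (simp add: algebra_simps)
    have "z powr P + P * z powr (P - 1) * (w - z) \<le> w powr P"
      by (rule powr_ge_tangent) (use zp w0 P in auto)
    then have "z powr P - w powr P \<le> P * z powr (P - 1) * (z - w)"
      by (simp add: algebra_simps)
    then have "?k powr (P - 1) * (1 + s) * (z powr P - w powr P)
        \<le> ?k powr (P - 1) * (1 + s) * (P * z powr (P - 1) * (z - w))"
      using s by (intro mult_left_mono) auto
    also have "\<dots> = P * (?k * z) powr (P - 1) * ((1 + s) * (z - w))"
      using st zp by (simp add: powr_mult mult_ac)
    also have "\<dots> \<le> P * (?k * z) powr (P - 1) * (\<bar>x - y\<bar> - ?k * z)"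
      using dist P by (intro mult_left_mono) auto
    also have "\<dots> \<le> \<bar>x - y\<bar> powr P - (?k * z) powr P"
      using powr_ge_tangent[of "?k * z" "\<bar>x - y\<bar>" P] st zp P by simp
    finally have "?k powr (P - 1) * (1 + s) * (z powr P - w powr P) \<le> \<bar>x - y\<bar> powr P - (?k * z) powr P" .
    moreover have "(?k * z) powr P = ?k powr P * z powr P" using st zp by (simp add: powr_mult)
    ultimately show ?thesis by (simp add: right_diff_distrib)
  qed
qed

text \<open>
  In the integral of the dual bound, the terms with the factor \<open>1 + s\<close> cancel, because the excesses
  of \<open>X\<close> and of \<open>Y\<close> have the same law.
\<close>

lemma transport_cost_lower:
  fixes X Y :: "'b \<Rightarrow> real"
  assumes [measurable]: "X \<in> borel_measurable M" "Y \<in> borel_measurable M"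
    and X: "distr M borel X = line_law c s" and Y: "distr M borel Y = line_law c t"
    and c: "0 \<le> c" and s: "0 \<le> s" and st: "s < t" and P: "1 \<le> P"
  shows "ennreal (((t - s) * c) powr P * excess_moment P) \<le> (\<integral>\<^sup>+ \<omega>. ennreal (\<bar>X \<omega> - Y \<omega>\<bar> powr P) \<partial>M)"
proof -
  define w where "w \<omega> = max (\<bar>X \<omega>\<bar> - c/2) 0 / (1 + s)" for \<omega>
  define z where "z \<omega> = max (\<bar>Y \<omega>\<bar> - c/2) 0 / (1 + t)" for \<omega>
  define q where "q = (t - s) powr (P - 1) * (1 + s)"
  let ?m = "c powr P * excess_moment P"
  have [measurable]: "w \<in> borel_measurable M" "z \<in> borel_measurable M"
    unfolding w_def z_def by measurable
  have m0: "0 \<le> ?m" by (simp add: excess_moment_def)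
  have q0: "0 \<le> q" using s by (simp add: q_def)
  have P0: "0 < P" and t: "0 \<le> t" using P s st by auto
  have wi: "(\<integral>\<^sup>+ \<omega>. ennreal (w \<omega> powr P) \<partial>M) = ennreal ?m"
    unfolding w_def by (rule line_law_excess_integral) (use X c s P0 in auto)
  have zi: "(\<integral>\<^sup>+ \<omega>. ennreal (z \<omega> powr P) \<partial>M) = ennreal ?m"
    unfolding z_def by (rule line_law_excess_integral) (use Y c t P0 in auto)
  have "ennreal ((t - s) powr P * ?m) + ennreal (q * ?m)
      = (\<integral>\<^sup>+ \<omega>. ennreal ((t - s) powr P) * ennreal (z \<omega> powr P) + ennreal q * ennreal (z \<omega> powr P) \<partial>M)"
    using m0 q0 by (subst nn_integral_add) (auto simp: nn_integral_cmult zi ennreal_mult)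
  also have "\<dots> \<le> (\<integral>\<^sup>+ \<omega>. ennreal (\<bar>X \<omega> - Y \<omega>\<bar> powr P) + ennreal q * ennreal (w \<omega> powr P) \<partial>M)"
  proof (rule nn_integral_mono)
    fix \<omega>
    have "(t - s) powr P * z \<omega> powr P + q * z \<omega> powr P \<le> \<bar>X \<omega> - Y \<omega>\<bar> powr P + q * w \<omega> powr P"
      unfolding q_def w_def z_def by (rule transport_cost_dual_bound[OF c s st P])
    then show "ennreal ((t - s) powr P) * ennreal (z \<omega> powr P) + ennreal q * ennreal (z \<omega> powr P)
        \<le> ennreal (\<bar>X \<omega> - Y \<omega>\<bar> powr P) + ennreal q * ennreal (w \<omega> powr P)"
      using q0 by (simp add: ennreal_mult[symmetric] ennreal_plus[symmetric] ennreal_leI del: ennreal_plus)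
  qed
  also have "\<dots> = (\<integral>\<^sup>+ \<omega>. ennreal (\<bar>X \<omega> - Y \<omega>\<bar> powr P) \<partial>M) + ennreal (q * ?m)"
    using m0 q0 by (subst nn_integral_add) (auto simp: nn_integral_cmult wi ennreal_mult)
  finally have "ennreal ((t - s) powr P * ?m) \<le> (\<integral>\<^sup>+ \<omega>. ennreal (\<bar>X \<omega> - Y \<omega>\<bar> powr P) \<partial>M)"
    by (simp add: add.commute[of _ "ennreal (q * ?m)"] ennreal_add_left_cancel_le)
  then show ?thesis using c st by (simp add: powr_mult mult.assoc)
qed

text \<open>
  \<open>X\<close> stays within \<open>c (1 + s/2)\<close>, whereas \<open>Y\<close> comes arbitrarily close to \<open>c (1 + t/2)\<close> with
  positive probability.
\<close>

lemma transport_sup_lower: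
  fixes X Y :: "'b \<Rightarrow> real"
  assumes [measurable]: "X \<in> borel_measurable M" "Y \<in> borel_measurable M"
    and X: "distr M borel X = line_law c s" and Y: "distr M borel Y = line_law c t"
    and c: "0 \<le> c" and s: "0 \<le> s" and st: "s < t"
    and e: "0 \<le> e" "AE \<omega> in M. \<bar>X \<omega> - Y \<omega>\<bar> \<le> e"
  shows "(t - s) * c / 2 \<le> e"
proof (rule ccontr)
  assume "\<not> ?thesis"
  then have less: "e < (t - s) * c / 2" by simp
  with e c st have cp: "0 < c" by (cases "c = 0") auto
  define b where "b = c * (1 + s/2) + e"
  have b: "b < c * (1 + t/2)" using less by (simp add: b_def field_simps)
  have "AE u in unif (- 1) 1. \<bar>c * spread s u\<bar> \<le> c * (1 + s/2)"
    using AE_unif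
  proof (rule eventually_mono)
    fix u :: real assume "- 1 \<le> u \<and> u \<le> 1"
    then have "\<bar>spread s u\<bar> \<le> 1 + s/2" using abs_spread_le[OF s, of u] by (simp add: abs_le_iff)
    then show "\<bar>c * spread s u\<bar> \<le> c * (1 + s/2)" using c by (simp add: abs_mult mult_left_mono)
  qed
  then have "AE x in distr M borel X. \<bar>x\<bar> \<le> c * (1 + s/2)"
    unfolding X line_law_def by (subst AE_distr_iff) auto
  then have "AE \<omega> in M. \<bar>X \<omega>\<bar> \<le> c * (1 + s/2)"
    by (subst (asm) AE_distr_iff) auto
  with e(2) have "AE \<omega> in M. \<bar>Y \<omega>\<bar> \<le> b"
    unfolding b_def by eventually_elim linarith
  then have "AE y in distr M borel Y. \<bar>y\<bar> \<le> b"
    by (subst AE_distr_iff) auto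
  then have AEb: "AE u in unif (- 1) 1. \<bar>c * spread t u\<bar> \<le> b"
    unfolding Y line_law_def by (subst (asm) AE_distr_iff) auto
  have t: "0 \<le> t" using s st by simp
  \<comment> \<open>The point beyond which \<open>spread t\<close>, dilated by \<open>c\<close>, exceeds the bound \<open>b\<close> on \<open>Y\<close>.\<close>
  define u0 where "u0 = max (1/2) ((b/c + t/2) / (1 + t))"
  have "b/c < 1 + t/2" using b cp by (simp add: pos_divide_less_eq mult.commute)
  then have u0: "1/2 \<le> u0" "u0 < 1"
    using t by (auto simp: u0_def pos_divide_less_eq)
  have big: "b < \<bar>c * spread t u\<bar>" if "u0 < u" for u
  proof -
    have u: "1/2 < u" "(b/c + t/2) / (1 + t) < u" using that by (auto simp: u0_def)
    then have "b/c < \<bar>spread t u\<bar>"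
      using t by (simp add: abs_spread excess_def field_simps)
    then show ?thesis using cp by (simp add: abs_mult field_simps)
  qed
  have "AE u in unif (- 1) 1. \<not> u0 < u"
    using AEb by (rule eventually_mono) (use big in force)
  then have "emeasure (unif (- 1) 1) {u. u0 < u} = 0"
    by (subst (asm) AE_iff_measurable[where N = "{u. u0 < u}"]) auto
  moreover have "{- 1..1} \<inter> {u. u0 < u} = {u0<..1}" using u0 by auto
  ultimately show False
    using u0 unfolding unif_def by (subst (asm) emeasure_uniform_measure) (auto simp: ennreal_divide_eq_0_iff)
qed

definition line_speed :: "ennreal \<Rightarrow> real" where
  "line_speed p = (if p = \<infinity> then 1/2 else excess_moment (enn2real p) powr (1 / enn2real p))"

lemma wasserstein_line_law:
  assumes c: "0 \<le> c" and s: "0 \<le> s" and t: "0 \<le> t" and p: "1 \<le> p"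
  shows "wasserstein p (line_law c s) (line_law c t) = \<bar>t - s\<bar> * (c * line_speed p)"
proof -
  let ?X = "\<lambda>u. c * spread s u" and ?Y = "\<lambda>u. c * spread t u" and ?U = "unif (- 1) 1"
  have U: "prob_space ?U" by (rule prob_space_unif) simp
  have XY: "?X \<in> borel_measurable ?U" "?Y \<in> borel_measurable ?U" by auto
  have dist: "dist (?X u) (?Y u) = \<bar>t - s\<bar> * c * excess u" for u
  proof -
    have "dist (?X u) (?Y u) = c * \<bar>spread s u - spread t u\<bar>"
      using c by (simp add: dist_real_def abs_mult right_diff_distrib[symmetric])
    then show ?thesis by (simp add: abs_spread_diff)
  qed
  have bnd: "AE u in ?U. dist (?X u) (?Y u) \<le> \<bar>t - s\<bar> * (c * (1/2))"
    using AE_unif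
  proof (rule eventually_mono)
    fix u :: real assume "- 1 \<le> u \<and> u \<le> 1"
    then have "excess u \<le> 1/2" by (intro excess_bounds) auto
    then have "\<bar>t - s\<bar> * c * excess u \<le> \<bar>t - s\<bar> * c * (1/2)" using c by (intro mult_left_mono) auto
    then show "dist (?X u) (?Y u) \<le> \<bar>t - s\<bar> * (c * (1/2))" unfolding dist by simp
  qed
  consider "s = t" | "s < t" | "t < s" by linarith
  note order = this
  show ?thesis
  proof (cases "p = \<infinity>")
    case True
    have "wasserstein \<infinity> (line_law c s) (line_law c t) \<le> \<bar>t - s\<bar> * (c * (1/2))"
      unfolding line_law_def by (rule wasserstein_infinity_le(1)[OF U XY _ bnd]) (use c in simp)
    moreover have "\<bar>t - s\<bar> * (c * (1/2)) \<le> wasserstein \<infinity> (line_law c s) (line_law c t)"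
      unfolding line_law_def
    proof (rule wasserstein_infinity_ge[OF U XY _ bnd])
      fix \<gamma> e assume \<gamma>: "\<gamma> \<in> couplings (distr ?U borel ?X) (distr ?U borel ?Y)"
        and e: "0 \<le> e" "AE (x, y) in \<gamma>. dist x y \<le> e"
      note D = couplingsD[OF \<gamma>, folded line_law_def]
      have AEe: "AE \<omega> in \<gamma>. \<bar>fst \<omega> - snd \<omega>\<bar> \<le> e" "AE \<omega> in \<gamma>. \<bar>snd \<omega> - fst \<omega>\<bar> \<le> e"
        using e(2) by (auto simp: case_prod_beta dist_real_def abs_minus_commute)
      show "\<bar>t - s\<bar> * (c * (1/2)) \<le> e"
        using order
      proof cases
        case 2
        then show ?thesis using transport_sup_lower[OF D(2,3,4,5) c s 2 e(1) AEe(1)] by simp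
      next
        case 3
        then show ?thesis using transport_sup_lower[OF D(3,2,5,4) c t 3 e(1) AEe(2)] by simp
      qed (use e in simp)
    qed (use c in simp)
    ultimately show ?thesis using True by (simp add: line_speed_def)
  next
    case False
    let ?P = "enn2real p"
    have P: "1 \<le> ?P" using p False enn2real_mono[of 1 p] by (simp add: less_top)
    then have P0: "0 < ?P" by simp
    let ?L = "\<bar>t - s\<bar> * (c * line_speed p)"
    have m0: "0 \<le> excess_moment ?P" by (simp add: excess_moment_def)
    have L0: "0 \<le> ?L" using c False by (simp add: line_speed_def)
    have "?L powr ?P = (\<bar>t - s\<bar> * c) powr ?P * line_speed p powr ?P"
      using c False by (simp add: powr_mult mult.assoc line_speed_def)
    also have "line_speed p powr ?P = excess_moment ?P"
      using False P0 m0 by (simp add: line_speed_def powr_powr)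
    finally have LP: "?L powr ?P = (\<bar>t - s\<bar> * c) powr ?P * excess_moment ?P" .
    have "(\<integral>\<^sup>+ u. ennreal (dist (?X u) (?Y u) powr ?P) \<partial>?U)
        = (\<integral>\<^sup>+ u. ennreal ((\<bar>t - s\<bar> * c) powr ?P) * ennreal (excess u powr ?P) \<partial>?U)"
      unfolding dist using c by (simp add: powr_mult excess_bounds ennreal_mult)
    also have "\<dots> = ennreal (?L powr ?P)"
      unfolding LP using P0 m0 by (subst nn_integral_cmult) (auto simp: nn_integral_excess_powr ennreal_mult)
    finally have "wasserstein p (line_law c s) (line_law c t) \<le> ?L"
      unfolding line_law_def by (intro wasserstein_le[OF U XY False P0 L0]) simp
    moreover have "?L \<le> wasserstein p (line_law c s) (line_law c t)"
      unfolding line_law_def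
    proof (rule wasserstein_ge[OF U XY False P0 L0 bnd])
      fix \<gamma> assume \<gamma>: "\<gamma> \<in> couplings (distr ?U borel ?X) (distr ?U borel ?Y)"
      note D = couplingsD[OF \<gamma>, folded line_law_def]
      show "ennreal (?L powr ?P) \<le> (\<integral>\<^sup>+ (x, y). ennreal (dist x y powr ?P) \<partial>\<gamma>)"
        using order
      proof cases
        case 2
        then show ?thesis unfolding LP using transport_cost_lower[OF D(2,3,4,5) c s 2 P]
          by (simp add: case_prod_unfold dist_real_def)
      next
        case 3
        then show ?thesis unfolding LP using transport_cost_lower[OF D(3,2,5,4) c t 3 P]
          by (simp add: case_prod_unfold dist_real_def abs_minus_commute)
      qed (use P0 in simp)
    qed
    ultimately show ?thesis by simp
  qed
qed

section \<open>The sliced distance is linear along the curve\<close>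

lemma cSUP_scale:
  fixes f :: "'b \<Rightarrow> real"
  assumes A: "A \<noteq> {}" and bdd: "bdd_above (f ` A)" and k: "0 \<le> k"
  shows "(SUP x\<in>A. k * f x) = k * (SUP x\<in>A. f x)"
proof (cases "k = 0")
  case True
  then show ?thesis using A by simp
next
  case False
  then have kp: "0 < k" using k by simp
  obtain B where "\<And>x. x \<in> A \<Longrightarrow> f x \<le> B" using bdd by (auto simp: bdd_above_def)
  then have bdd': "bdd_above ((\<lambda>x. k * f x) ` A)"
    using k by (intro bdd_aboveI2[where M = "k * B"]) (auto intro: mult_left_mono)
  show ?thesis
  proof (rule antisym)
    show "(SUP x\<in>A. k * f x) \<le> k * (SUP x\<in>A. f x)"
      using k by (intro cSUP_least A mult_left_mono cSUP_upper bdd)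
    have "(SUP x\<in>A. f x) \<le> (SUP x\<in>A. k * f x) / k"
    proof (rule cSUP_least[OF A])
      fix x assume "x \<in> A"
      then have "k * f x \<le> (SUP x\<in>A. k * f x)" by (rule cSUP_upper[OF _ bdd'])
      then show "f x \<le> (SUP x\<in>A. k * f x) / k" using kp by (simp add: pos_le_divide_eq mult.commute)
    qed
    then show "k * (SUP x\<in>A. f x) \<le> (SUP x\<in>A. k * f x)"
      using kp by (simp add: pos_le_divide_eq mult.commute)
  qed
qed

text \<open>
  Only the homogeneity of supremum and integral matters, so the argument is the same for every
  measure on the sphere of directions. If the normalising factor is degenerate or the integrand is not
  integrable, both sides are \<open>0\<close>.
\<close>

lemma sliced_wasserstein_scale:
  fixes \<mu> \<nu> \<mu>' \<nu>' :: "'a::euclidean_space measure"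
  assumes scale: "\<And>\<theta>. wasserstein p (slice \<theta> \<mu>') (slice \<theta> \<nu>') = k * wasserstein p (slice \<theta> \<mu>) (slice \<theta> \<nu>)"
    and nonneg: "\<And>\<theta>. 0 \<le> wasserstein p (slice \<theta> \<mu>) (slice \<theta> \<nu>)"
    and bdd: "bdd_above ((\<lambda>\<theta>. wasserstein p (slice \<theta> \<mu>) (slice \<theta> \<nu>)) ` sphere 0 1)"
    and k: "0 \<le> k" and q: "1 \<le> q"
  shows "sliced_wasserstein p q \<mu>' \<nu>' = k * sliced_wasserstein p q \<mu> \<nu>"
proof (cases "q = \<infinity>")
  case True
  obtain b :: 'a where "b \<in> Basis" using nonempty_Basis by blast
  then have "b \<in> sphere 0 1" by simp
  then have "sphere (0 :: 'a) 1 \<noteq> {}" by blast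
  then show ?thesis
    unfolding sliced_wasserstein_def if_P[OF True] scale by (rule cSUP_scale[OF _ bdd k])
next
  case False
  let ?Q = "enn2real q" and ?H = "hausdorff_measure (DIM('a) - 1) :: 'a measure"
  have Q: "1 \<le> ?Q" using q False enn2real_mono[of 1 q] by (simp add: less_top)
  let ?f = "\<lambda>\<theta>. wasserstein p (slice \<theta> \<mu>) (slice \<theta> \<nu>)"
  let ?J = "1 / measure ?H (sphere 0 1) * (LINT \<theta>:sphere 0 1|?H. ?f \<theta> powr ?Q)"
  have J: "0 \<le> ?J"
    unfolding set_lebesgue_integral_def
    by (intro mult_nonneg_nonneg Bochner_Integration.integral_nonneg) (auto simp: indicator_def)
  have "sliced_wasserstein p q \<mu>' \<nu>'
      = (1 / measure ?H (sphere 0 1) * (LINT \<theta>:sphere 0 1|?H. k powr ?Q * ?f \<theta> powr ?Q)) powr (1 / ?Q)"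
    using False k nonneg by (simp add: sliced_wasserstein_def scale powr_mult)
  also have "\<dots> = (k powr ?Q * ?J) powr (1 / ?Q)" by simp
  also have "\<dots> = (k powr ?Q) powr (1 / ?Q) * ?J powr (1 / ?Q)"
    by (rule powr_mult)
  also have "(k powr ?Q) powr (1 / ?Q) = k" using k Q by (simp add: powr_powr)
  finally show ?thesis using False by (simp add: sliced_wasserstein_def)
qed

context orthonormal_triple
begin

lemma AE_norm_position_le: "AE \<omega> in base_space. norm (position t \<omega>) \<le> 2" if "0 \<le> t" "t \<le> 1"
  using AE_norm_position[OF that(1)] by (rule eventually_mono) (use radius_bounds[OF that] in simp)

lemma mixture_in_wasserstein_space:
  assumes t: "0 \<le> t" "t \<le> 1"
  shows "mixture t \<in> wasserstein_space p"
proof -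
  interpret prob_space base_space by (rule prob_space_base_space)
  have "prob_space (mixture t)" unfolding mixture_def by (rule prob_space_distr) simp
  moreover have "bounded (measure_support (mixture t))"
  proof (rule bounded_subset)
    show "measure_support (mixture t) \<subseteq> cball 0 2"
    proof
      fix x assume x: "x \<in> measure_support (mixture t)"
      show "x \<in> cball 0 2"
      proof (rule ccontr)
        assume "x \<notin> cball 0 2"
        then have pos: "0 < emeasure (mixture t) (- cball 0 2)"
          using x by (auto simp: measure_support_def open_Compl)
        have "AE x in mixture t. norm x \<le> 2"
          unfolding mixture_def using AE_norm_position_le[OF t] by (subst AE_distr_iff) auto
        then have "emeasure (mixture t) (- cball 0 2) = 0"
          by (subst (asm) AE_iff_measurable[where N = "- cball 0 2"]) (auto simp: mixture_def)
        then show False using pos by simp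
      qed
    qed
  qed simp
  moreover have "(\<integral>\<^sup>+ x. ennreal (norm x powr enn2real p) \<partial>mixture t) < \<infinity>"
  proof -
    have "(\<integral>\<^sup>+ x. ennreal (norm x powr enn2real p) \<partial>mixture t)
        = (\<integral>\<^sup>+ \<omega>. ennreal (norm (position t \<omega>) powr enn2real p) \<partial>base_space)"
      unfolding mixture_def by (subst nn_integral_distr) auto
    also have "\<dots> \<le> (\<integral>\<^sup>+ \<omega>. ennreal (2 powr enn2real p) \<partial>base_space)"
      using AE_norm_position_le[OF t]
      by (intro nn_integral_mono_AE) (auto elim!: eventually_mono intro!: ennreal_leI powr_mono2)
    also have "\<dots> < \<infinity>" by (simp add: emeasure_space_1)
    finally show ?thesis .
  qed
  ultimately show ?thesis by (simp add: wasserstein_space_def mixture_def)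
qed

lemma wasserstein_slice_mixture:
  assumes "0 \<le> s" "s \<le> 1" "0 \<le> t" "t \<le> 1" "1 \<le> p"
  shows "wasserstein p (slice \<theta> (mixture s)) (slice \<theta> (mixture t)) = \<bar>t - s\<bar> * (proj_norm \<theta> * line_speed p)"
  using assms wasserstein_line_law[OF proj_norm_nonneg, of s t p \<theta>]
  by (simp add: slice_mixture line_law_def[symmetric])

lemma line_speed_nonneg: "0 \<le> line_speed p"
  by (simp add: line_speed_def)

lemma proj_norm_le: "norm \<theta> = 1 \<Longrightarrow> proj_norm \<theta> \<le> sqrt 3"
proof -
  assume th: "norm \<theta> = 1"
  have "(\<theta> \<bullet> e)\<^sup>2 \<le> 1" if "e \<bullet> e = 1" for e
    using Cauchy_Schwarz_ineq[of \<theta> e] that th by (simp add: dot_square_norm)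
  from this[OF unit(1)] this[OF unit(2)] this[OF unit(3)]
  show ?thesis unfolding proj_norm_def by (intro real_sqrt_le_mono) simp
qed

lemma sliced_wasserstein_mixture:
  assumes st: "0 \<le> s" "s \<le> 1" "0 \<le> t" "t \<le> 1" and p: "1 \<le> p" and q: "1 \<le> q"
  shows "sliced_wasserstein p q (mixture s) (mixture t) = \<bar>t - s\<bar> * sliced_wasserstein p q (mixture 0) (mixture 1)"
proof (rule sliced_wasserstein_scale[OF _ _ _ abs_ge_zero q])
  have W: "wasserstein p (slice \<theta> (mixture 0)) (slice \<theta> (mixture 1)) = proj_norm \<theta> * line_speed p" for \<theta>
    using wasserstein_slice_mixture[of 0 1 p \<theta>] p by simp
  show "wasserstein p (slice \<theta> (mixture s)) (slice \<theta> (mixture t))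
      = \<bar>t - s\<bar> * wasserstein p (slice \<theta> (mixture 0)) (slice \<theta> (mixture 1))" for \<theta>
    unfolding W by (rule wasserstein_slice_mixture[OF st p])
  show "0 \<le> wasserstein p (slice \<theta> (mixture 0)) (slice \<theta> (mixture 1))" for \<theta>
    unfolding W using proj_norm_nonneg line_speed_nonneg by simp
  show "bdd_above ((\<lambda>\<theta>. wasserstein p (slice \<theta> (mixture 0)) (slice \<theta> (mixture 1))) ` sphere 0 1)"
    unfolding W using proj_norm_le line_speed_nonneg
    by (intro bdd_aboveI2[where M = "sqrt 3 * line_speed p"] mult_right_mono) auto
qed

section \<open>The Wasserstein distance is not Lipschitz along the curve\<close>

lemma emeasure_mixture_small_ball:
  assumes t: "0 \<le> t" "t \<le> 1"
  shows "emeasure (mixture t) {x. norm x \<le> 1/2} = ennreal (t / (2 * (1 + t)))"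
proof -
  interpret U: prob_space "unif 0 1" by (rule prob_space_unif) simp
  interpret A: prob_space angles by (rule prob_space_angles)
  have "emeasure (mixture t) {x. norm x \<le> 1/2} = emeasure base_space {\<omega>. norm (position t \<omega>) \<le> 1/2}"
    unfolding mixture_def by (subst emeasure_distr) (auto simp: vimage_def base_space_def angles_def space_pair_measure)
  also have "\<dots> = emeasure base_space {\<omega>. fst \<omega> \<le> t / (2 * (1 + t))}"
  proof (rule emeasure_eq_AE)
    show "AE \<omega> in base_space. (\<omega> \<in> {\<omega>. norm (position t \<omega>) \<le> 1/2}) = (\<omega> \<in> {\<omega>. fst \<omega> \<le> t / (2 * (1 + t))})"
      using AE_norm_position[OF t(1)] by (rule eventually_mono) (use t in \<open>auto simp: radius_def\<close>)
    have sp: "space base_space = UNIV" by (simp add: base_space_def angles_def space_pair_measure)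
    have "{\<omega> \<in> space base_space. norm (position t \<omega>) \<le> 1/2} \<in> sets base_space" by measurable
    then show "{\<omega>. norm (position t \<omega>) \<le> 1/2} \<in> sets base_space" by (simp add: sp)
    have "{\<omega> \<in> space base_space. fst \<omega> \<le> t / (2 * (1 + t))} \<in> sets base_space" by measurable
    then show "{\<omega>. fst \<omega> \<le> t / (2 * (1 + t))} \<in> sets base_space" by (simp add: sp)
  qed
  also have "\<dots> = emeasure (distr base_space (unif 0 1) fst) {v. v \<le> t / (2 * (1 + t))}"
    by (subst emeasure_distr) (auto simp: vimage_def base_space_def angles_def space_pair_measure)
  also have "distr base_space (unif 0 1) fst = unif 0 1"
    unfolding base_space_def by (rule A.distr_pair_fst)
  also have "emeasure (unif 0 1) {v. v \<le> t / (2 * (1 + t))} = ennreal (t / (2 * (1 + t)))"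
    by (simp only: U.emeasure_eq_measure prob_radius_small[OF t])
  finally show ?thesis .
qed

text \<open>
  At time \<open>0\<close> all mass has distance \<open>1\<close> from the origin; at time \<open>t\<close> a mass of at least \<open>t/4\<close> has
  distance \<open>1/2\<close>. Hence every transport plan moves a mass of at least \<open>t/4\<close> over a distance of at
  least \<open>1/2\<close>, and the Wasserstein distance is at least half the \<open>p\<close>-th root of \<open>t/4\<close>, where the
  \<open>p\<close>-th root of \<open>1/4\<close> is at least \<open>1/4\<close>. For \<open>p = \<infinity>\<close> the
  exponent reads \<open>1 / enn2real \<infinity> = 1 / 0 = 0\<close>, as it should.
\<close>

lemma wasserstein_mixture_ge:
  assumes t: "0 < t" "t \<le> 1" and p: "1 \<le> p"
  shows "t powr (1 / enn2real p) / 8 \<le> wasserstein p (mixture 0) (mixture t)"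
proof -
  have t0: "0 \<le> t" using t by simp
  have small: "AE x in mixture 0. 1 \<le> norm x"
  proof -
    have "AE v in unif 0 1. \<not> v \<le> 0"
    proof (subst AE_iff_measurable[where N = "{v. v \<le> 0}"])
      interpret U: prob_space "unif 0 1" by (rule prob_space_unif) simp
      show "emeasure (unif 0 1) {v. v \<le> 0} = 0"
        using prob_radius_small[of 0] by (simp add: U.emeasure_eq_measure)
    qed auto
    then have "AE \<omega> in base_space. \<not> fst \<omega> \<le> 0"
      unfolding base_space_def by (intro AE_pair_fst prob_space_unif prob_space_angles) auto
    with AE_norm_position[OF order_refl] have "AE \<omega> in base_space. 1 \<le> norm (position 0 \<omega>)"
      by eventually_elim (simp add: radius_def)
    then show ?thesis unfolding mixture_def by (subst AE_distr_iff) auto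
  qed
  define a where "a = t / (2 * (1 + t))"
  have a: "t / 4 \<le> a" using t by (simp add: a_def field_simps)
  have far: "AE \<omega> in \<gamma>. norm (snd \<omega>) \<le> 1/2 \<longrightarrow> 1/2 \<le> dist (fst \<omega>) (snd \<omega>)"
    and mass: "emeasure \<gamma> {\<omega> \<in> space \<gamma>. norm (snd \<omega>) \<le> 1/2} = ennreal a"
    if \<gamma>: "\<gamma> \<in> couplings (mixture 0) (mixture t)" for \<gamma>
  proof -
    note D = couplingsD[OF \<gamma>]
    note [measurable] = D(2,3)
    have "AE x in distr \<gamma> borel fst. 1 \<le> norm x" unfolding D(4) by (rule small)
    then have "AE \<omega> in \<gamma>. 1 \<le> norm (fst \<omega>)" by (subst (asm) AE_distr_iff) auto
    then show "AE \<omega> in \<gamma>. norm (snd \<omega>) \<le> 1/2 \<longrightarrow> 1/2 \<le> dist (fst \<omega>) (snd \<omega>)"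
    proof (rule eventually_mono, intro impI)
      fix \<omega> :: "'a \<times> 'a" assume "1 \<le> norm (fst \<omega>)" "norm (snd \<omega>) \<le> 1/2"
      then show "1/2 \<le> dist (fst \<omega>) (snd \<omega>)"
        using norm_triangle_ineq2[of "fst \<omega>" "snd \<omega>"] by (simp add: dist_norm)
    qed
    have "emeasure (distr \<gamma> borel snd) {x. norm x \<le> 1/2} = ennreal a"
      unfolding D(5) a_def by (rule emeasure_mixture_small_ball[OF t0 t(2)])
    then show "emeasure \<gamma> {\<omega> \<in> space \<gamma>. norm (snd \<omega>) \<le> 1/2} = ennreal a"
      by (subst (asm) emeasure_distr) (auto simp: vimage_def Int_def conj_commute)
  qed
  note B = prob_space_base_space measurable_position[of 0] measurable_position[of t]
  have bnd: "AE \<omega> in base_space. dist (position 0 \<omega>) (position t \<omega>) \<le> 4"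
    using AE_norm_position_le[OF order_refl zero_le_one] AE_norm_position_le[OF t0 t(2)]
  proof eventually_elim
    case (elim \<omega>)
    then show ?case
      using norm_triangle_ineq4[of "position 0 \<omega>" "position t \<omega>"] by (simp add: dist_norm)
  qed
  show ?thesis
  proof (cases "p = \<infinity>")
    case True
    have "1/8 \<le> wasserstein \<infinity> (mixture 0) (mixture t)"
      unfolding mixture_def
    proof (rule wasserstein_infinity_ge[OF B _ bnd], simp)
      fix \<gamma> e assume \<gamma>: "\<gamma> \<in> couplings (distr base_space borel (position 0)) (distr base_space borel (position t))"
        and e: "0 \<le> e" "AE (x, y) in \<gamma>. dist x y \<le> e"
      note \<gamma>' = \<gamma>[folded mixture_def]
      note [measurable] = couplingsD(2,3)[OF \<gamma>']
      show "1/8 \<le> e"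
      proof (rule ccontr)
        assume "\<not> 1/8 \<le> e"
        with far[OF \<gamma>'] e(2) have "AE \<omega> in \<gamma>. \<not> norm (snd \<omega>) \<le> 1/2"
          by (auto simp: case_prod_beta elim!: eventually_elim2)
        then have "emeasure \<gamma> {\<omega> \<in> space \<gamma>. norm (snd \<omega>) \<le> 1/2} = 0"
          by (subst (asm) AE_iff_measurable[where N = "{\<omega> \<in> space \<gamma>. norm (snd \<omega>) \<le> 1/2}"]) auto
        then show False using mass[OF \<gamma>'] a t by simp
      qed
    qed
    then show ?thesis using True t by simp
  next
    case False
    let ?P = "enn2real p" and ?L = "t powr (1 / enn2real p) / 8"
    have P: "1 \<le> ?P" using p False enn2real_mono[of 1 p] by (simp add: less_top)
    have "(1/4 :: real) powr ?P \<le> (1/4) powr 1" using P by (intro powr_mono') auto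
    then have "(1/2) powr ?P * ((1/4) powr ?P * t) \<le> (1/2) powr ?P * (1/4 * t)"
      using t by (intro mult_left_mono mult_right_mono) auto
    moreover have "(1/8 :: real) powr ?P = (1/2) powr ?P * (1/4) powr ?P"
      by (simp add: powr_mult[symmetric])
    moreover have "?L = 1/8 * t powr (1 / ?P)" by simp
    then have "?L powr ?P = (1/8) powr ?P * t"
      using t P by (simp only: powr_mult) (simp add: powr_powr)
    ultimately have LP: "?L powr ?P \<le> (1/2) powr ?P * a"
      using mult_left_mono[OF a, of "(1/2) powr ?P"] by simp
    show ?thesis
      unfolding mixture_def
    proof (rule wasserstein_ge[OF B False _ _ bnd])
      fix \<gamma> assume \<gamma>: "\<gamma> \<in> couplings (distr base_space borel (position 0)) (distr base_space borel (position t))"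
      note \<gamma>' = \<gamma>[folded mixture_def]
      note [measurable] = couplingsD(2,3)[OF \<gamma>']
      let ?S = "{\<omega> \<in> space \<gamma>. norm (snd \<omega>) \<le> 1/2}"
      have "ennreal (?L powr ?P) \<le> ennreal ((1/2) powr ?P) * emeasure \<gamma> ?S"
        unfolding mass[OF \<gamma>'] using LP a t by (simp add: ennreal_mult[symmetric] ennreal_leI)
      also have "\<dots> = (\<integral>\<^sup>+ \<omega>. ennreal ((1/2) powr ?P) * indicator ?S \<omega> \<partial>\<gamma>)"
        by (subst nn_integral_cmult_indicator) auto
      also have "\<dots> \<le> (\<integral>\<^sup>+ \<omega>. ennreal (dist (fst \<omega>) (snd \<omega>) powr ?P) \<partial>\<gamma>)"
        using far[OF \<gamma>'] P
        by (intro nn_integral_mono_AE) (auto elim!: eventually_mono simp: indicator_def intro!: ennreal_leI powr_mono2)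
      finally show "ennreal (?L powr ?P) \<le> (\<integral>\<^sup>+ (x, y). ennreal (dist x y powr ?P) \<partial>\<gamma>)"
        by (simp add: case_prod_unfold)
    qed (use P in auto)
  qed
qed

lemma geodesic_mixture:
  assumes "1 \<le> p" "1 \<le> q"
  shows "geodesic_in (wasserstein_space p) (sliced_wasserstein p q) mixture"
  unfolding geodesic_in_def
proof (intro conjI ballI)
  fix s t :: real assume "s \<in> {0..1}" "t \<in> {0..1}"
  then show "sliced_wasserstein p q (mixture t) (mixture s) = \<bar>t - s\<bar> * sliced_wasserstein p q (mixture 0) (mixture 1)"
    using sliced_wasserstein_mixture[of t s p q] assms by (simp add: abs_minus_commute)
qed (use mixture_in_wasserstein_space in auto)

text \<open>
  Along the curve, the sliced distance from the starting point is linear in \<open>t\<close>, while the Wasserstein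
  distance is at least a multiple of \<open>t\<^sup>e\<close> with \<open>e = 1/p < 1\<close>.
\<close>

lemma not_bi_lipschitz_mixture:
  assumes p: "1 < p" and q: "1 \<le> q" and X: "mixture ` {0..1} \<subseteq> X"
  shows "\<not> bi_lipschitz_equivalent X (wasserstein p) (sliced_wasserstein p q)"
proof
  assume "bi_lipschitz_equivalent X (wasserstein p) (sliced_wasserstein p q)"
  then obtain C where C: "1 \<le> C"
    and le: "\<And>x y. x \<in> X \<Longrightarrow> y \<in> X \<Longrightarrow> inverse C * wasserstein p x y \<le> sliced_wasserstein p q x y"
    unfolding bi_lipschitz_equivalent_def by blast
  define K where "K = max 1 (sliced_wasserstein p q (mixture 0) (mixture 1))"
  define e where "e = 1 / enn2real p"
  have K: "1 \<le> K" by (simp add: K_def)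
  have e: "e < 1"
  proof (cases "p = \<infinity>")
    case False
    then have "p = ennreal (enn2real p)" by (simp add: less_top)
    then have "1 < enn2real p" using p by (metis ennreal_1 ennreal_less_iff zero_le_one)
    then show ?thesis by (simp add: e_def)
  qed (simp add: e_def)
  \<comment> \<open>At this time \<open>t\<close> the lower bound \<open>t\<^sup>e / (8 C)\<close> is exactly twice the upper bound \<open>t K\<close>.\<close>
  define t where "t = (1 / (16 * C * K)) powr (1 / (1 - e))"
  have CK: "1 \<le> C * K" using C K mult_mono[of 1 C 1 K] by simp
  have t: "0 < t" "t \<le> 1"
    using CK e by (auto simp: t_def mult.assoc powr_le_one_le intro!: powr_le1)
  have te: "t powr (1 - e) = 1 / (16 * C * K)"
    using e CK C K by (simp add: t_def powr_powr)
  have "inverse C * (t powr e / 8) \<le> inverse C * wasserstein p (mixture 0) (mixture t)"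
    using wasserstein_mixture_ge[OF t, of p] p C by (intro mult_left_mono) (auto simp: e_def)
  also have "\<dots> \<le> sliced_wasserstein p q (mixture 0) (mixture t)"
    using X t by (intro le) auto
  also have "\<dots> = t * sliced_wasserstein p q (mixture 0) (mixture 1)"
    using sliced_wasserstein_mixture[of 0 t p q] t p q by simp
  also have "\<dots> \<le> t * K" using t by (simp add: K_def)
  also have "\<dots> = (t powr (1 - e) * K) * t powr e"
  proof -
    have "t powr (1 - e) * t powr e = t" using t by (simp add: powr_add[symmetric])
    then show ?thesis by (metis mult.assoc mult.commute)
  qed
  finally have "inverse C / 8 * t powr e \<le> (t powr (1 - e) * K) * t powr e" by simp
  then have "inverse C / 8 \<le> t powr (1 - e) * K" using t by simp
  then show False unfolding te using C K by (simp add: field_simps)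
qed

end

theorem proposition4p2:
  fixes p q :: ennreal
  assumes "DIM('a::euclidean_space) \<ge> 3"
    and "1 < p" and "1 \<le> q"
  shows "\<not> bi_lipschitz_equivalent (wasserstein_space p :: 'a measure set)
             (wasserstein p) (sliced_wasserstein p q) \<and>
         (\<exists>\<mu> :: real \<Rightarrow> 'a measure.
            geodesic_in (wasserstein_space p) (sliced_wasserstein p q) \<mu> \<and>
            \<not> bi_lipschitz_equivalent (\<mu> ` {0..1}) (wasserstein p) (sliced_wasserstein p q))"
proof -
  obtain T :: "'a set" where T: "T \<subseteq> Basis" "card T = 3"
    using obtain_subset_with_card_n[OF assms(1)] by metis
  then obtain e1 e2 e3 where "T = {e1, e2, e3}" "e1 \<noteq> e2" "e1 \<noteq> e3" "e2 \<noteq> e3"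
    unfolding card_3_iff by blast
  with T interpret orthonormal_triple e1 e2 e3
    by unfold_locales (auto simp: inner_not_same_Basis)
  have p: "1 \<le> p" using assms(2) by simp
  show ?thesis
    using geodesic_mixture[OF p assms(3)] not_bi_lipschitz_mixture[OF assms(2,3), of "wasserstein_space p"]
      not_bi_lipschitz_mixture[OF assms(2,3) order_refl] mixture_in_wasserstein_space[of _ p]
    by (intro conjI exI[of _ mixture]) (auto simp: image_subset_iff)
qed

end
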